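(* Let $K$ be a commutative Noetherian ring with $1$, let $A$ be a $K$-algebra (associative, not necessarily commutative or with $1$), and let $B$ be a $K$-subalgebra of $A$ such that $A/B$ is a finitely generated $K$-module. Then $A$ is finitely presented as a $K$-algebra if and only if $B$ is finitely presented as a $K$-algebra.
   Context: A $K$-algebra is a structure that is simultaneously an associative ring (not necessarily with identity) and a $K$-module, with $K$-bilinear multiplication. The free $K$-algebra $K\langle X\rangle$ on a set $X$ is the semigroup ring over $K$ of the free semigroup $X^+$ (non-commuting variables, no identity). A $K$-algebra is finitely generated if it is isomorphic to $K\langle X\rangle/I$ with $X$ finite and $I$ an ideal; it is finitely presented if moreover $I$ can be chosen finitely generated as an ideal. *)

theory Defs
  imports Main
begin

definition k_ideal :: "'k::comm_ring_1 set \<Rightarrow> bool" where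
  "k_ideal I \<longleftrightarrow> 0 \<in> I \<and> (\<forall>x\<in>I. \<forall>y\<in>I. x + y \<in> I) \<and> (\<forall>r. \<forall>x\<in>I. r * x \<in> I)"

definition k_ideal_span :: "'k::comm_ring_1 set \<Rightarrow> 'k set" where
  "k_ideal_span G = {(\<Sum>g\<in>G. r g * g) | r. True}"

definition noetherian_cring :: "'k::comm_ring_1 itself \<Rightarrow> bool" where
  "noetherian_cring _ \<longleftrightarrow>
     (\<forall>I :: 'k set. k_ideal I \<longrightarrow> (\<exists>G. finite G \<and> G \<subseteq> I \<and> I = k_ideal_span G))"

definition kalg :: "('k::comm_ring_1 \<Rightarrow> 'a::ring \<Rightarrow> 'a) \<Rightarrow> bool" where
  "kalg smul \<longleftrightarrow>
     (\<forall>x. smul 1 x = x) \<and>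
     (\<forall>a b x. smul (a * b) x = smul a (smul b x)) \<and>
     (\<forall>a b x. smul (a + b) x = smul a x + smul b x) \<and>
     (\<forall>a x y. smul a (x + y) = smul a x + smul a y) \<and>
     (\<forall>a x y. smul a (x * y) = smul a x * y) \<and>
     (\<forall>a x y. smul a (x * y) = x * smul a y)"

definition subalg :: "('k::comm_ring_1 \<Rightarrow> 'a::ring \<Rightarrow> 'a) \<Rightarrow> 'a set \<Rightarrow> bool" where
  "subalg smul B \<longleftrightarrow> 0 \<in> B \<and> (\<forall>x\<in>B. \<forall>y\<in>B. x + y \<in> B \<and> x * y \<in> B) \<and>
     (\<forall>c. \<forall>x\<in>B. smul c x \<in> B)"

definition fg_quotient_module :: "('k::comm_ring_1 \<Rightarrow> 'a::ring \<Rightarrow> 'a) \<Rightarrow> 'a set \<Rightarrow> bool" where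
  "fg_quotient_module smul B \<longleftrightarrow>
     (\<exists>T. finite T \<and> (\<forall>a. \<exists>b\<in>B. \<exists>c. a = b + (\<Sum>t\<in>T. smul (c t) t)))"

text \<open>Elements: finitely supported K-valued functions on the free semigroup X^+
  (nonempty words over X).\<close>
definition fa_carrier :: "nat set \<Rightarrow> (nat list \<Rightarrow> 'k::comm_ring_1) set" where
  "fa_carrier X = {p. finite {w. p w \<noteq> 0} \<and> (\<forall>w. p w \<noteq> 0 \<longrightarrow> w \<noteq> [] \<and> set w \<subseteq> X)}"

definition fa_add :: "(nat list \<Rightarrow> 'k::comm_ring_1) \<Rightarrow> (nat list \<Rightarrow> 'k) \<Rightarrow> nat list \<Rightarrow> 'k" where
  "fa_add p q = (\<lambda>w. p w + q w)"

definition fa_smul :: "'k::comm_ring_1 \<Rightarrow> (nat list \<Rightarrow> 'k) \<Rightarrow> nat list \<Rightarrow> 'k" where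
  "fa_smul c p = (\<lambda>w. c * p w)"

text \<open>Semigroup-ring multiplication: concatenation of nonempty words.\<close>
definition fa_mult :: "(nat list \<Rightarrow> 'k::comm_ring_1) \<Rightarrow> (nat list \<Rightarrow> 'k) \<Rightarrow> nat list \<Rightarrow> 'k" where
  "fa_mult p q = (\<lambda>w. \<Sum>i\<in>{1..<length w}. p (take i w) * q (drop i w))"

definition fa_ideal :: "nat set \<Rightarrow> (nat list \<Rightarrow> 'k::comm_ring_1) set \<Rightarrow> bool" where
  "fa_ideal X I \<longleftrightarrow> I \<subseteq> fa_carrier X \<and> (\<lambda>_. 0) \<in> I \<and>
     (\<forall>p\<in>I. \<forall>q\<in>I. fa_add p q \<in> I) \<and>
     (\<forall>c. \<forall>p\<in>I. fa_smul c p \<in> I) \<and>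
     (\<forall>p\<in>I. \<forall>q\<in>fa_carrier X. fa_mult p q \<in> I \<and> fa_mult q p \<in> I)"

definition fa_ideal_gen :: "nat set \<Rightarrow> (nat list \<Rightarrow> 'k::comm_ring_1) set \<Rightarrow> (nat list \<Rightarrow> 'k) set" where
  "fa_ideal_gen X G = \<Inter>{I. fa_ideal X I \<and> G \<subseteq> I}"

definition fa_hom :: "nat set \<Rightarrow> ('k::comm_ring_1 \<Rightarrow> 'a::ring \<Rightarrow> 'a) \<Rightarrow> 'a set
                      \<Rightarrow> ((nat list \<Rightarrow> 'k) \<Rightarrow> 'a) \<Rightarrow> bool" where
  "fa_hom X smul S \<phi> \<longleftrightarrow>
     (\<forall>p\<in>fa_carrier X. \<phi> p \<in> S) \<and>
     (\<forall>p\<in>fa_carrier X. \<forall>q\<in>fa_carrier X.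
        \<phi> (fa_add p q) = \<phi> p + \<phi> q \<and> \<phi> (fa_mult p q) = \<phi> p * \<phi> q) \<and>
     (\<forall>c. \<forall>p\<in>fa_carrier X. \<phi> (fa_smul c p) = smul c (\<phi> p))"

text \<open>The K-algebra S (a subalgebra of 'a, with the induced operations) is finitely
  presented: S \<cong> K<X>/I with X finite and I a finitely generated ideal, i.e. there is a
  surjective K-algebra homomorphism K<X> \<rightarrow> S whose kernel is finitely generated.\<close>
definition fin_pres :: "('k::comm_ring_1 \<Rightarrow> 'a::ring \<Rightarrow> 'a) \<Rightarrow> 'a set \<Rightarrow> bool" where
  "fin_pres smul S \<longleftrightarrow>
     (\<exists>X \<phi>. finite X \<and> fa_hom X smul S \<phi> \<and> \<phi> ` fa_carrier X = S \<and>
        (\<exists>G. finite G \<and> G \<subseteq> fa_carrier X \<and>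
             {p \<in> fa_carrier X. \<phi> p = 0} = fa_ideal_gen X G))"

end

theory Submission
  imports Defs "HOL.Modules" "HOL-Library.Poly_Mapping"
begin

text \<open>
  Upwards: if B is presented and A = B + KT with T finite, add generators for T, finitely many
  relations rewriting the products xt, tx, tt' into B + KT, and the finitely many relations
  expressing a generating set of the K-module of those linear forms in T with value in B
  (Noetherianity).

  Downwards: let K<X> map onto A, and let S be the preimage of B. As K<X> = S + KF with F finite,
  the kernel is finitely generated as an ideal of S, so it suffices to present S. Say S contains
  r(w) = w + (terms of length at most n) for all words w of length m = n + 1. The part S(N) of
  degree at most N = 2n + 1 is a finitely generated K-module; take its generators as algebra
  generators. Beyond degree N every element is obtained degree by degree from
  S(d) = (sum over w of r(w) S(d - m)) + S(d - 1), and mirroring this recursion in the free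
  algebra gives a filtration Q(d) mapping onto S(d). Since the words w have the same length, the
  top degree parts of the r(w) p(w) cannot cancel, so a relation in Q(d) descends to Q(d - 1):
  finitely many relations of low degree imply all others.
\<close>

subsection \<open>Modules and ideals\<close>

text \<open>The obstacle downwards: the degree in X of an element of S does not control the length
  of the monomials in generators of S that express it. Long monomials may cancel to something of low
  degree, so relations cannot be bounded by their length. Hence an element of the presenting algebra
  is measured by the degree of its image, and only through expressions of one prescribed recursive
  shape; separate relations must then make these expressions exhaust the algebra.

  The number n bounds the degrees of F, so every element is congruent modulo S to one of degree at
  most n. Length n + 1 is the first at which a word is sure to exceed its correction. The threshold
  is (n + 1) + n, the degree of a product of some r(w) with a correction; above it such a product is
  an error of lower degree.

  Noetherianity enters only through submodules of finitely generated K-modules, never through ideals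
  of a noncommutative algebra.\<close>

locale k_algebra = module smul for smul :: "'k::comm_ring_1 \<Rightarrow> 'a::ring \<Rightarrow> 'a" +
  assumes smul_mult_left: "smul c (x * y) = smul c x * y"
    and smul_mult_right: "smul c (x * y) = x * smul c y"
begin

definition ideal_in :: "'a set \<Rightarrow> 'a set \<Rightarrow> bool" where
  "ideal_in S I \<longleftrightarrow> subspace I \<and> I \<subseteq> S \<and> (\<forall>x\<in>I. \<forall>s\<in>S. s * x \<in> I \<and> x * s \<in> I)"

lemma ideal_inD:
  assumes "ideal_in S I"
  shows "subspace I" and "I \<subseteq> S"
    and "x \<in> I \<Longrightarrow> s \<in> S \<Longrightarrow> s * x \<in> I" and "x \<in> I \<Longrightarrow> s \<in> S \<Longrightarrow> x * s \<in> I"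
  using assms by (auto simp: ideal_in_def)

lemma subspace_mult_vimage:
  assumes "subspace M"
  shows "subspace {x. y * x \<in> M}" and "subspace {x. x * y \<in> M}"
  using assms by (auto simp: subspace_def distrib_left distrib_right
      simp flip: smul_mult_left smul_mult_right)

lemma subspace_plus:
  assumes "subspace M" "subspace N"
  shows "subspace {x + y |x y. x \<in> M \<and> y \<in> N}"
  unfolding subspace_def
proof (intro conjI ballI allI)
  show "0 \<in> {x + y |x y. x \<in> M \<and> y \<in> N}"
    using assms by (force dest: subspace_0)
next
  fix u v assume "u \<in> {x + y |x y. x \<in> M \<and> y \<in> N}" "v \<in> {x + y |x y. x \<in> M \<and> y \<in> N}"
  then obtain x y x' y' where "u = x + y" "v = x' + y'" "x \<in> M" "y \<in> N" "x' \<in> M" "y' \<in> N"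
    by auto
  then have "u + v = (x + x') + (y + y')" "x + x' \<in> M" "y + y' \<in> N"
    using assms by (auto intro: subspace_add)
  then show "u + v \<in> {x + y |x y. x \<in> M \<and> y \<in> N}" by blast
next
  fix c u assume "u \<in> {x + y |x y. x \<in> M \<and> y \<in> N}"
  then show "smul c u \<in> {x + y |x y. x \<in> M \<and> y \<in> N}"
    using assms by (auto simp: scale_right_distrib) (blast intro: subspace_scale)
qed

lemma subalgD:
  assumes "subalg smul S"
  shows "subspace S" and "x \<in> S \<Longrightarrow> y \<in> S \<Longrightarrow> x * y \<in> S"
  using assms by (auto simp: subalg_def subspace_def)

end

lemma kalg_iff_k_algebra: "kalg smul \<longleftrightarrow> k_algebra smul"
  unfolding kalg_def k_algebra_def k_algebra_axioms_def module_def by (auto; metis)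

text \<open>Leading coefficients at \<open>t\<close>: lifts of generators of the ideal
  \<open>C\<close>, together with generators of \<open>N \<inter> span T\<close>, generate
  \<open>N\<close>. As the generators need not be independent, an element of \<open>N\<close> may
  have several coefficients at \<open>t\<close>, and \<open>C\<close> admits all of them.\<close>

lemma (in module) submodule_fg:
  assumes noeth: "noetherian_cring TYPE('a)"
    and "finite T" and "subspace N" and "N \<subseteq> span T"
  shows "\<exists>G. finite G \<and> G \<subseteq> N \<and> span G = N"
  using \<open>finite T\<close> \<open>subspace N\<close> \<open>N \<subseteq> span T\<close>
proof (induction T arbitrary: N rule: finite_induct)
  case empty
  then show ?case using subspace_0 by (intro exI[of _ "{}"]) auto
next
  case (insert t T)
  define C where "C = {c. \<exists>x\<in>N. x - scale c t \<in> span T}"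
  have "k_ideal C"
    unfolding k_ideal_def
  proof (intro conjI ballI allI)
    show "0 \<in> C"
      using subspace_0[OF insert.prems(1)] span_zero by (force simp: C_def)
  next
    fix c d assume "c \<in> C" "d \<in> C"
    then obtain x y where "x \<in> N" "y \<in> N" "x - scale c t \<in> span T" "y - scale d t \<in> span T"
      by (auto simp: C_def)
    then show "c + d \<in> C"
      using span_add[of "x - scale c t" T "y - scale d t"] subspace_add[OF insert.prems(1)]
      by (auto simp: C_def algebra_simps intro!: bexI[of _ "x + y"])
  next
    fix r c assume "c \<in> C"
    then obtain x where "x \<in> N" "x - scale c t \<in> span T" by (auto simp: C_def)
    then show "r * c \<in> C"
      using span_scale[of "x - scale c t" T r] subspace_scale[OF insert.prems(1)]
      by (auto simp: C_def algebra_simps intro!: bexI[of _ "scale r x"])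
  qed
  then obtain H where H: "finite H" "H \<subseteq> C" "C = k_ideal_span H"
    using noeth by (auto simp: noetherian_cring_def)
  then have "\<forall>c\<in>H. \<exists>x\<in>N. x - scale c t \<in> span T"
    by (auto simp: C_def)
  then obtain f where f: "f c \<in> N" "f c - scale c t \<in> span T" if "c \<in> H" for c
    by metis
  obtain G where G: "finite G" "G \<subseteq> N \<inter> span T" "span G = N \<inter> span T"
    using insert.IH[of "N \<inter> span T"] insert.prems subspace_inter by auto
  have "N \<subseteq> span (f ` H \<union> G)"
  proof
    fix x assume x: "x \<in> N"
    then obtain c where c: "x - scale c t \<in> span T"
      using insert.prems(2) span_breakdown_eq by blast
    then have "c \<in> C" using x by (auto simp: C_def)
    then obtain r where r: "c = (\<Sum>g\<in>H. r g * g)" using H(3) by (auto simp: k_ideal_span_def)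
    let ?y = "\<Sum>g\<in>H. scale (r g) (f g)"
    have "?y \<in> N" using f insert.prems(1) by (auto intro!: subspace_sum subspace_scale)
    moreover have "(\<Sum>g\<in>H. scale (r g) (f g - scale g t)) \<in> span T"
      using f by (auto intro!: span_sum span_scale)
    then have "?y - scale c t \<in> span T"
      by (simp add: r algebra_simps sum_subtractf scale_sum_left)
    then have "x - ?y \<in> span T" using span_diff[OF c] by (fastforce simp: algebra_simps)
    ultimately have "x - ?y \<in> span G"
      using G x insert.prems(1) subspace_diff by blast
    then have "x - ?y \<in> span (f ` H \<union> G)" using span_mono[of G "f ` H \<union> G"] by auto
    moreover have "?y \<in> span (f ` H \<union> G)" by (auto intro!: span_sum span_scale intro: span_base)
    ultimately show "x \<in> span (f ` H \<union> G)" using span_add by fastforce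
  qed
  moreover have "f ` H \<union> G \<subseteq> N" using f G by auto
  ultimately show ?case
    using G(1) H(1) insert.prems(1) span_minimal[of "f ` H \<union> G" N]
    by (intro exI[of _ "f ` H \<union> G"]) blast
qed

subsection \<open>The free algebra\<close>

text \<open>With concatenation as addition of exponents, the convolution product of finitely supported
  functions is the multiplication of the free algebra with unit; K<X> is the part supported on
  nonempty words over X.\<close>

instantiation list :: (type) monoid_add
begin
definition zero_list :: "'a list" where "zero_list = []"
definition plus_list :: "'a list \<Rightarrow> 'a list \<Rightarrow> 'a list" where "plus_list = (@)"
instance by standard (auto simp: zero_list_def plus_list_def)
end

type_synonym 'k fa = "nat list \<Rightarrow>\<^sub>0 'k"

abbreviation coeff :: "'k::zero fa \<Rightarrow> nat list \<Rightarrow> 'k" where "coeff \<equiv> Poly_Mapping.lookup"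
abbreviation supp :: "'k::zero fa \<Rightarrow> nat list set" where "supp \<equiv> Poly_Mapping.keys"

definition word :: "nat list \<Rightarrow> 'k::comm_ring_1 fa" where
  "word w = Poly_Mapping.single w 1"

definition fscale :: "'k::comm_ring_1 \<Rightarrow> 'k fa \<Rightarrow> 'k fa" where
  "fscale c p = Poly_Mapping.single [] c * p"

lemma word_mult: "word u * word v = word (u @ v)"
  by (simp add: word_def mult_single plus_list_def)

lemma fscale_eq_map: "fscale c p = Poly_Mapping.map ((*) c) p"
  by (simp add: fscale_def mult_map_scale_conv_mult zero_list_def)

lemma lookup_fscale [simp]: "coeff (fscale c p) w = c * coeff p w"
  by (simp add: fscale_eq_map map.rep_eq when_def)

lemma supp_fscale: "supp (fscale c p) \<subseteq> supp p"
  by (metis in_keys_iff lookup_fscale mult_zero_right subsetI)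

lemma fscale_word: "fscale c (word w) = Poly_Mapping.single w c"
  by (simp add: fscale_def word_def mult_single plus_list_def)

lemma poly_eq_sum_word: "p = (\<Sum>w\<in>supp p. fscale (coeff p w) (word w))"
  by (rule poly_mapping_eqI)
    (auto simp: lookup_sum fscale_word lookup_single when_def not_in_keys_iff_lookup_eq_zero)

lemma lookup_word: "coeff (word w) v = (1 when w = v)"
  by (simp add: word_def lookup_single)

text \<open>A prefix shifts the coefficients. Hence products with distinct words of equal length
  have disjoint supports, which later excludes cancellation of leading terms.\<close>

lemma lookup_word_mult:
  "coeff (word u * p) w = (if take (length u) w = u then coeff p (drop (length u) w) else 0)"
proof -
  have split: "w = u + q \<longleftrightarrow> take (length u) w = u \<and> q = drop (length u) w" for q
    unfolding plus_list_def using append_eq_conv_conj[of u q w] by auto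
  have "coeff (word u * p) w = (\<Sum>l. (\<Sum>q. coeff p q when w = l + q) when u = l)"
    unfolding lookup_mult lookup_word by (rule Sum_any.cong) (simp add: when_def)
  also have "\<dots> = (\<Sum>q. coeff p q when w = u + q)"
    by simp
  also have "\<dots> = (\<Sum>q. (coeff p q when take (length u) w = u) when q = drop (length u) w)"
    by (rule Sum_any.cong) (simp add: split when_def)
  also have "\<dots> = (coeff p (drop (length u) w) when take (length u) w = u)"
    by simp
  finally show ?thesis by (simp add: when_def)
qed

text \<open>Multiples of the empty word are central because the scalars commute; checked on words
  and extended linearly.\<close>

lemma fscale_commute: "p * fscale c q = fscale c (p * q)"
proof -
  have "word w * fscale c q = fscale c (word w * q)" for w
    by (rule poly_mapping_eqI) (auto simp: lookup_word_mult)
  then have *: "word w * fscale c q = Poly_Mapping.single [] c * (word w * q)" for w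
    by (simp add: fscale_def)
  have "fscale d (word w) * fscale c q = fscale c (fscale d (word w) * q)" for d w
  proof -
    have "fscale d (word w) * fscale c q
        = (Poly_Mapping.single [] d * Poly_Mapping.single [] c) * (word w * q)"
      using * by (simp add: fscale_def mult.assoc)
    also have "Poly_Mapping.single [] d * Poly_Mapping.single [] c
        = Poly_Mapping.single [] c * (Poly_Mapping.single [] d :: 'a fa)"
      by (simp add: mult_single mult.commute)
    finally show ?thesis by (simp add: fscale_def mult.assoc)
  qed
  then have "(\<Sum>w\<in>supp p. fscale (coeff p w) (word w)) * fscale c q
      = fscale c ((\<Sum>w\<in>supp p. fscale (coeff p w) (word w)) * q)"
    by (simp add: sum_distrib_right) (simp add: fscale_def sum_distrib_left)
  then show ?thesis by (simp flip: poly_eq_sum_word)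
qed

text \<open>With a free algebra itself as target, \<open>fa.eval\<close>, \<open>fa.ideal_in\<close>
  and \<open>fa.presents\<close> treat subalgebras of K<X> by the same notions as subalgebras of
  A.\<close>

interpretation fa: k_algebra fscale
proof
  show "fscale c (p * q) = p * fscale c q" for c :: 'a and p q :: "'a fa"
    by (simp add: fscale_commute)
  show "fscale 1 p = p" for p :: "'a fa"
    by (rule poly_mapping_eqI) simp
qed (simp_all add: fscale_def distrib_left distrib_right mult.assoc single_add mult_single plus_list_def
      flip: mult.assoc)

lemma span_words: "fa.span (word ` P) = {p :: 'a::comm_ring_1 fa. supp p \<subseteq> P}"
proof
  show "{p :: 'a fa. supp p \<subseteq> P} \<subseteq> fa.span (word ` P)"
  proof
    fix p :: "'a fa" assume p: "p \<in> {p. supp p \<subseteq> P}"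
    have "(\<Sum>w\<in>supp p. fscale (coeff p w) (word w)) \<in> fa.span (word ` P)"
      by (rule fa.span_sum, rule fa.span_scale, rule fa.span_base) (use p in blast)
    then show "p \<in> fa.span (word ` P)" by (subst poly_eq_sum_word)
  qed
  have "fa.subspace {p :: 'a fa. supp p \<subseteq> P}"
    unfolding fa.subspace_def
  proof (intro conjI ballI allI)
    show "p + q \<in> {p. supp p \<subseteq> P}" if "p \<in> {p. supp p \<subseteq> P}" "q \<in> {p. supp p \<subseteq> P}"
      for p q :: "'a fa"
      using that keys_add[of p q] by blast
    show "fscale c p \<in> {p. supp p \<subseteq> P}" if "p \<in> {p. supp p \<subseteq> P}" for c and p :: "'a fa"
      using that supp_fscale[of c p] by blast
  qed simp
  then show "fa.span (word ` P) \<subseteq> {p :: 'a fa. supp p \<subseteq> P}"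
    by (intro fa.span_minimal) (auto simp: word_def)
qed

definition fcar :: "nat set \<Rightarrow> 'k::comm_ring_1 fa set" where
  "fcar X = {p. \<forall>w\<in>supp p. w \<noteq> [] \<and> set w \<subseteq> X}"

lemma fcar_eq_span: "fcar X = fa.span (word ` {w. w \<noteq> [] \<and> set w \<subseteq> X})"
  unfolding span_words fcar_def by auto

text \<open>Linear extension from words. The first case asks for a submodule of the whole unital
  free algebra, not merely of \<open>fcar X\<close>.\<close>

lemma fcar_induct [consumes 1, case_names subspace word]:
  assumes "p \<in> fcar X" and "fa.subspace {p. P p}"
    and "\<And>w. w \<noteq> [] \<Longrightarrow> set w \<subseteq> X \<Longrightarrow> P (word w)"
  shows "P p"
  using assms(1) unfolding fcar_eq_span
  by (induction rule: fa.span_induct) (use assms in auto)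

lemma word_in_fcar: "w \<noteq> [] \<Longrightarrow> set w \<subseteq> X \<Longrightarrow> word w \<in> fcar X"
  by (auto simp: fcar_def word_def)

lemma subspace_fcar: "fa.subspace (fcar X)"
  unfolding fcar_eq_span by (rule fa.subspace_span)

lemma fcar_mult:
  assumes "p \<in> fcar X" and q: "q \<in> fcar X"
  shows "p * q \<in> fcar X"
  using assms(1)
proof (induction p rule: fcar_induct)
  case subspace
  show ?case by (rule fa.subspace_mult_vimage(2)[OF subspace_fcar])
next
  case (word w)
  from q show ?case
  proof (induction q rule: fcar_induct)
    case subspace
    show ?case by (rule fa.subspace_mult_vimage(1)[OF subspace_fcar])
  next
    case (word w')
    then show ?case using \<open>set w \<subseteq> X\<close> \<open>w \<noteq> []\<close> by (auto simp: word_mult intro!: word_in_fcar)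
  qed
qed

lemma subalg_fcar: "subalg fscale (fcar X)"
  using subspace_fcar[of X] fcar_mult by (auto simp: subalg_def fa.subspace_def)

lemma fcar_mono: "X \<subseteq> Y \<Longrightarrow> fcar X \<subseteq> fcar Y"
  by (force simp: fcar_def)

subsection \<open>Presentations\<close>

context k_algebra
begin

text \<open>The empty word has no value in an algebra without unit; 0 is a junk value.\<close>
fun word_val :: "(nat \<Rightarrow> 'a) \<Rightarrow> nat list \<Rightarrow> 'a" where
  "word_val a [] = 0"
| "word_val a [i] = a i"
| "word_val a (i # j # w) = a i * word_val a (j # w)"

lemma word_val_Cons: "w \<noteq> [] \<Longrightarrow> word_val a (i # w) = a i * word_val a w"
  by (cases w) auto

lemma word_val_append:
  "u \<noteq> [] \<Longrightarrow> v \<noteq> [] \<Longrightarrow> word_val a (u @ v) = word_val a u * word_val a v"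
  by (induction a u rule: word_val.induct) (auto simp: word_val_Cons mult.assoc)

definition eval :: "(nat \<Rightarrow> 'a) \<Rightarrow> 'k fa \<Rightarrow> 'a" where
  "eval a p = (\<Sum>w\<in>supp p. smul (coeff p w) (word_val a w))"

lemma eval_superset:
  "finite F \<Longrightarrow> supp p \<subseteq> F \<Longrightarrow> eval a p = (\<Sum>w\<in>F. smul (coeff p w) (word_val a w))"
  unfolding eval_def by (rule sum.mono_neutral_left) (auto simp: not_in_keys_iff_lookup_eq_zero)

lemma module_hom_eval: "module_hom fscale smul (eval a)"
proof
  fix p q :: "'k fa"
  have "eval a r = (\<Sum>w\<in>supp p \<union> supp q. smul (coeff r w) (word_val a w))"
    if "r \<in> {p, q, p + q}" for r
    using that keys_add[of p q] by (intro eval_superset) auto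
  then show "eval a (p + q) = eval a p + eval a q"
    by (simp add: lookup_add scale_left_distrib sum.distrib)
next
  fix c and p :: "'k fa"
  have "eval a (fscale c p) = (\<Sum>w\<in>supp p. smul (coeff (fscale c p) w) (word_val a w))"
    by (rule eval_superset) (simp_all add: supp_fscale)
  then show "eval a (fscale c p) = smul c (eval a p)"
    by (simp add: eval_def scale_sum_right)
qed

lemmas eval_add = module_hom.add[OF module_hom_eval]
  and eval_scale = module_hom.scale[OF module_hom_eval]
  and eval_zero = module_hom.zero[OF module_hom_eval]
  and eval_diff = module_hom.diff[OF module_hom_eval]

lemma eval_word: "eval a (word w) = word_val a w"
  by (simp add: eval_def word_def)

lemma eval_mult:
  assumes "p \<in> fcar X" "q \<in> fcar X"
  shows "eval a (p * q) = eval a p * eval a q"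
  using assms
proof (induction p rule: fcar_induct)
  case subspace
  then show ?case
    by (auto simp: fa.subspace_def distrib_right eval_add eval_scale eval_zero simp flip: fa.smul_mult_left smul_mult_left)
next
  case (word w)
  from \<open>q \<in> fcar X\<close> show ?case
  proof (induction q rule: fcar_induct)
    case subspace
    then show ?case
      by (auto simp: fa.subspace_def distrib_left eval_add eval_scale eval_zero simp flip: fa.smul_mult_right smul_mult_right)
  next
    case (word w')
    then show ?case using \<open>w \<noteq> []\<close> by (simp add: word_mult eval_word word_val_append)
  qed
qed

lemma eval_in_subalg:
  assumes "subalg smul S" "a ` X \<subseteq> S" "p \<in> fcar X"
  shows "eval a p \<in> S"
  using assms(3)
proof (induction p rule: fcar_induct)
  case subspace
  then show ?case
    using subalgD(1)[OF assms(1)] by (auto simp: fa.subspace_def subspace_def eval_add eval_scale eval_zero)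
next
  case (word w)
  then show ?case unfolding eval_word
    by (induction w rule: list_nonempty_induct)
      (use assms(2) in \<open>auto simp: word_val_Cons intro!: subalgD(2)[OF assms(1)]\<close>)
qed

text \<open>The uniqueness half of the universal property; it allows presentations to be given by
  the values of the letters instead of by homomorphisms.\<close>

lemma hom_eq_eval:
  assumes add: "\<And>p q. p \<in> fcar X \<Longrightarrow> q \<in> fcar X \<Longrightarrow> \<phi> (p + q) = \<phi> p + \<phi> q"
    and mult: "\<And>p q. p \<in> fcar X \<Longrightarrow> q \<in> fcar X \<Longrightarrow> \<phi> (p * q) = \<phi> p * \<phi> q"
    and scale: "\<And>c p. p \<in> fcar X \<Longrightarrow> \<phi> (fscale c p) = smul c (\<phi> p)"
    and p: "p \<in> fcar X"
    and gen: "\<And>i. i \<in> X \<Longrightarrow> a i = \<phi> (word [i])"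
  shows "\<phi> p = eval a p"
proof -
  \<comment> \<open>The laws of \<open>\<phi>\<close> hold on \<open>fcar X\<close> only, so
    membership has to be carried along for the claim to define a submodule.\<close>
  have "p \<in> fcar X \<and> \<phi> p = eval a p"
    using p
  proof (induction p rule: fcar_induct)
    case subspace
    have "\<phi> 0 = 0"
      using add[of 0 0] fa.subspace_0[OF subspace_fcar[of X]] by simp
    then show ?case
      using subspace_fcar[of X]
      by (auto simp: fa.subspace_def add scale eval_add eval_scale eval_zero)
  next
    case (word w)
    then have "\<phi> (word w) = word_val a w"
    proof (induction w rule: list_nonempty_induct)
      case (cons i w)
      then have "\<phi> (word [i] * word w) = \<phi> (word [i]) * \<phi> (word w)"
        by (intro mult word_in_fcar) auto
      then show ?case using cons gen[of i] by (simp add: word_mult word_val_Cons)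
    qed (use gen in auto)
    then show ?case using word by (simp add: eval_word word_in_fcar)
  qed
  then show ?thesis ..
qed

lemma eval_cong:
  "p \<in> fcar X \<Longrightarrow> (\<And>i. i \<in> X \<Longrightarrow> a i = b i) \<Longrightarrow> eval a p = eval b p"
  by (rule hom_eq_eval[of X "eval a"]) (auto simp: eval_add eval_mult eval_scale eval_word)

text \<open>The last clause puts the kernel into the ideal generated by \<open>G\<close> without
  constructing that ideal. The kernel is itself an ideal, so \<open>eval a g = 0\<close> on
  \<open>G\<close> gives the other inclusion.\<close>

definition presents :: "nat set \<Rightarrow> (nat \<Rightarrow> 'a) \<Rightarrow> 'k fa set \<Rightarrow> 'a set \<Rightarrow> bool" where
  "presents X a G S \<longleftrightarrow> finite X \<and> eval a ` fcar X = S \<and> finite G \<and> G \<subseteq> fcar X \<and>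
     (\<forall>g\<in>G. eval a g = 0) \<and>
     (\<forall>I. fa.ideal_in (fcar X) I \<longrightarrow> G \<subseteq> I \<longrightarrow> (\<forall>p\<in>fcar X. eval a p = 0 \<longrightarrow> p \<in> I))"

lemma ideal_in_kernel: "fa.ideal_in (fcar X) {p \<in> fcar X. eval a p = 0}"
  using subspace_fcar[of X]
  by (auto simp: fa.ideal_in_def fa.subspace_def eval_add eval_scale eval_zero eval_mult fcar_mult)

text \<open>It suffices to test ideals contained in the kernel: intersect with it.\<close>
lemma presentsI:
  assumes "finite X" "eval a ` fcar X = S" "finite G" "G \<subseteq> fcar X" "\<And>g. g \<in> G \<Longrightarrow> eval a g = 0"
    and ker: "\<And>I p. fa.ideal_in (fcar X) I \<Longrightarrow> G \<subseteq> I \<Longrightarrow> (\<And>q. q \<in> I \<Longrightarrow> eval a q = 0) \<Longrightarrow>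
      p \<in> fcar X \<Longrightarrow> eval a p = 0 \<Longrightarrow> p \<in> I"
  shows "presents X a G S"
  unfolding presents_def
proof (intro conjI allI impI ballI)
  fix I p assume I: "fa.ideal_in (fcar X) I" "G \<subseteq> I" and p: "p \<in> fcar X" "eval a p = 0"
  have "fa.ideal_in (fcar X) (I \<inter> {p \<in> fcar X. eval a p = 0})"
    using I(1) ideal_in_kernel[of X a] fa.subspace_inter unfolding fa.ideal_in_def by blast
  then have "p \<in> I \<inter> {p \<in> fcar X. eval a p = 0}"
    using assms(4,5) I(2) p by - (rule ker[of "I \<inter> {p \<in> fcar X. eval a p = 0}" p]; blast)
  then show "p \<in> I" ..
qed (use assms(1-5) in blast)+

end

section \<open>Translation between polynomial mappings and the functions of
  \<open>fa_carrier\<close>\<close>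

lemma inj_coeff: "inj coeff"
  by (rule injI) (simp only: lookup_inject)

lemma coeff_in_carrier: "coeff p \<in> fa_carrier X \<longleftrightarrow> p \<in> fcar X"
  unfolding fa_carrier_def fcar_def Ball_def in_keys_iff by simp

lemma fa_carrier_eq: "fa_carrier X = coeff ` (fcar X :: 'a::comm_ring_1 fa set)"
proof
  show "fa_carrier X \<subseteq> coeff ` (fcar X :: 'a fa set)"
  proof
    fix f :: "nat list \<Rightarrow> 'a" assume f: "f \<in> fa_carrier X"
    then have "coeff (Abs_poly_mapping f) = f" by (simp add: fa_carrier_def)
    then show "f \<in> coeff ` fcar X" using f by (metis coeff_in_carrier imageI)
  qed
qed (auto simp: coeff_in_carrier)

lemma fa_add_coeff: "fa_add (coeff p) (coeff q) = coeff (p + q)"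
  by (auto simp: fa_add_def lookup_add)

lemma fa_smul_coeff: "fa_smul c (coeff p) = coeff (fscale c p)"
  by (auto simp: fa_smul_def)

lemma fa_mult_coeff:
  assumes "p \<in> fcar X" and q: "q \<in> fcar X"
  shows "fa_mult (coeff p) (coeff q) = coeff (p * q :: 'a::comm_ring_1 fa)"
  using assms(1)
proof (induction p rule: fcar_induct)
  case subspace
  then show ?case
    by (auto simp: fa.subspace_def fa_mult_def fun_eq_iff lookup_add distrib_right sum.distrib
        mult.assoc simp flip: fa.smul_mult_left sum_distrib_left)
next
  case (word u)
  \<comment> \<open>\<open>fa_mult\<close> omits the two splits with an empty factor. They
    contribute nothing: \<open>u\<close> is nonempty and \<open>q\<close> vanishes at the empty
    word.\<close>
  have Nil: "coeff q [] = 0"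
    using q by (auto simp: fcar_def not_in_keys_iff_lookup_eq_zero)
  have "(\<Sum>i\<in>{1..<length w}. coeff (word u) (take i w) * coeff q (drop i w)) = coeff (word u * q) w"
    for w
  proof (cases "take (length u) w = u \<and> length u < length w")
    case True
    then have "length u \<in> {1..<length w}" using word by (cases u) auto
    moreover have "coeff (word u :: 'a fa) (take i w) = 0" if "i < length w" "i \<noteq> length u" for i
    proof -
      have "u \<noteq> take i w" using that by auto
      then show ?thesis by (simp add: lookup_word)
    qed
    ultimately have "(\<Sum>i\<in>{1..<length w}. coeff (word u) (take i w) * coeff q (drop i w))
       = (\<Sum>i\<in>{length u}. coeff (word u) (take i w) * coeff q (drop i w))"
      by (intro sum.mono_neutral_right ballI) simp_all
    with True show ?thesis by (simp add: lookup_word_mult lookup_word)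
  next
    case False
    then have "coeff (word u * q) w = 0"
      using Nil by (auto simp: lookup_word_mult)
    moreover have "coeff (word u :: 'a fa) (take i w) = 0" if "i < length w" for i
    proof -
      have "u \<noteq> take i w" using that False by auto
      then show ?thesis by (simp add: lookup_word)
    qed
    ultimately show ?thesis by (simp add: sum.neutral)
  qed
  then show ?case by (simp add: fa_mult_def fun_eq_iff)
qed

lemma fa_ideal_coeff: "fa_ideal X (coeff ` I) \<longleftrightarrow> fa.ideal_in (fcar X) I"
proof -
  have zero: "(\<lambda>_. 0) = coeff 0" by (simp add: fun_eq_iff)
  have mem: "coeff p \<in> coeff ` J \<longleftrightarrow> p \<in> J" for p and J :: "'a fa set"
    by (rule inj_image_mem_iff[OF inj_coeff])
  have mult: "fa_mult (coeff p) (coeff q) \<in> coeff ` I \<longleftrightarrow> p * q \<in> I"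
    if "p \<in> fcar X" "q \<in> fcar X" for p q
    using that by (simp add: fa_mult_coeff mem)
  show ?thesis
  proof (cases "I \<subseteq> fcar X")
    case True
    then show ?thesis
      unfolding fa_ideal_def fa.ideal_in_def fa.subspace_def fa_carrier_eq zero ball_simps
      by (simp add: mem fa_add_coeff fa_smul_coeff inj_image_subset_iff[OF inj_coeff])
        (use mult in blast)
  next
    case False
    then show ?thesis
      unfolding fa_ideal_def fa.ideal_in_def fa_carrier_eq
      by (simp add: inj_image_subset_iff[OF inj_coeff])
  qed
qed

text \<open>Every ideal of functions lies in \<open>fa_carrier X\<close>, hence is the image of a
  set of polynomial mappings; the intersection defining the generated ideal may thus range over
  ideals of \<open>fcar X\<close>.\<close>

lemma coeff_subset_ideal_gen:
  assumes "J \<subseteq> fcar X"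
  shows "coeff ` J \<subseteq> fa_ideal_gen X (coeff ` G) \<longleftrightarrow>
     (\<forall>I. fa.ideal_in (fcar X) I \<longrightarrow> G \<subseteq> I \<longrightarrow> J \<subseteq> I)"
proof -
  have "coeff ` J \<subseteq> fa_ideal_gen X (coeff ` G) \<longleftrightarrow>
     (\<forall>I'. fa_ideal X I' \<longrightarrow> coeff ` G \<subseteq> I' \<longrightarrow> coeff ` J \<subseteq> I')"
    unfolding fa_ideal_gen_def by blast
  also have "\<dots> \<longleftrightarrow> (\<forall>I. fa_ideal X (coeff ` I) \<longrightarrow> coeff ` G \<subseteq> coeff ` I \<longrightarrow> coeff ` J \<subseteq> coeff ` I)"
  proof (intro iffI allI impI)
    fix I' assume *: "\<forall>I. fa_ideal X (coeff ` I) \<longrightarrow> coeff ` G \<subseteq> coeff ` I \<longrightarrow> coeff ` J \<subseteq> coeff ` I"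
      and I': "fa_ideal X I'" "coeff ` G \<subseteq> I'"
    from I'(1) obtain I where "I' = coeff ` I"
      unfolding fa_ideal_def fa_carrier_eq subset_image_iff by blast
    then show "coeff ` J \<subseteq> I'" using * I' by blast
  qed blast
  finally show ?thesis
    by (simp add: fa_ideal_coeff inj_image_subset_iff[OF inj_coeff])
qed

context k_algebra
begin

lemma presents_imp_fin_pres:
  assumes "presents X a G S"
  shows "fin_pres smul S"
  unfolding fin_pres_def
proof (intro exI conjI)
  define \<phi> where "\<phi> f = eval a (Abs_poly_mapping f)" for f
  have \<phi>: "\<phi> (coeff p) = eval a p" for p
    by (simp add: \<phi>_def lookup_inverse)
  show "finite X" "finite (coeff ` G)" "coeff ` G \<subseteq> fa_carrier X"
    using assms by (auto simp: presents_def fa_carrier_eq)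
  show im: "\<phi> ` fa_carrier X = S"
    using assms by (simp add: presents_def fa_carrier_eq image_image \<phi>)
  show "fa_hom X smul S \<phi>"
    unfolding fa_hom_def
  proof (intro conjI)
    show "\<forall>p\<in>fa_carrier X. \<phi> p \<in> S" using im by auto
  qed (auto simp: fa_carrier_eq fa_add_coeff fa_smul_coeff fa_mult_coeff \<phi> eval_add eval_mult eval_scale)
  have ker: "{p \<in> fa_carrier X. \<phi> p = 0} = coeff ` {p \<in> fcar X. eval a p = 0}"
    by (auto simp: fa_carrier_eq \<phi>)
  show "{p \<in> fa_carrier X. \<phi> p = 0} = fa_ideal_gen X (coeff ` G)"
  proof
    show "{p \<in> fa_carrier X. \<phi> p = 0} \<subseteq> fa_ideal_gen X (coeff ` G)"
      unfolding ker using assms by (subst coeff_subset_ideal_gen) (auto simp: presents_def)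
    have "coeff ` G \<subseteq> coeff ` {p \<in> fcar X. eval a p = 0}"
      using assms by (auto simp: presents_def)
    then show "fa_ideal_gen X (coeff ` G) \<subseteq> {p \<in> fa_carrier X. \<phi> p = 0}"
      unfolding ker fa_ideal_gen_def using ideal_in_kernel[of X a] by (auto simp flip: fa_ideal_coeff)
  qed
qed

lemma fin_pres_imp_presents:
  assumes "fin_pres smul S"
  shows "\<exists>X a G. presents X a G S"
proof -
  obtain X \<phi> G where X: "finite X" and hom: "fa_hom X smul S \<phi>" and im: "\<phi> ` fa_carrier X = S"
    and G: "finite G" "G \<subseteq> fa_carrier X" and ker: "{p \<in> fa_carrier X. \<phi> p = 0} = fa_ideal_gen X G"
    using assms unfolding fin_pres_def by blast
  define a where "a i = \<phi> (coeff (word [i]))" for i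
  have ev: "\<phi> (coeff p) = eval a p" if "p \<in> fcar X" for p
    using that hom
    by (intro hom_eq_eval[where \<phi> = "\<lambda>p. \<phi> (coeff p)" and X = X])
      (auto simp: a_def fa_hom_def fa_carrier_eq fa_add_coeff fa_smul_coeff fa_mult_coeff)
  obtain H where H: "finite H" "H \<subseteq> fcar X" "G = coeff ` H"
    using G unfolding fa_carrier_eq by (meson finite_subset_image)
  have ker': "coeff ` {p \<in> fcar X. eval a p = 0} = fa_ideal_gen X (coeff ` H)"
    unfolding H(3)[symmetric] ker[symmetric] by (auto simp: fa_carrier_eq ev)
  have "presents X a H S"
    unfolding presents_def
  proof (intro conjI)
    show "eval a ` fcar X = S"
      unfolding im[symmetric] fa_carrier_eq image_image using ev by (simp cong: image_cong)
    have "coeff ` H \<subseteq> coeff ` {p \<in> fcar X. eval a p = 0}"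
      unfolding ker' fa_ideal_gen_def by blast
    then show "\<forall>g\<in>H. eval a g = 0"
      by (auto simp: inj_image_subset_iff[OF inj_coeff])
    have "coeff ` {p \<in> fcar X. eval a p = 0} \<subseteq> fa_ideal_gen X (coeff ` H)"
      using ker' by simp
    then show "\<forall>I. fa.ideal_in (fcar X) I \<longrightarrow> H \<subseteq> I \<longrightarrow> (\<forall>p\<in>fcar X. eval a p = 0 \<longrightarrow> p \<in> I)"
      by (subst (asm) coeff_subset_ideal_gen) auto
  qed (use X H in auto)
  then show ?thesis by blast
qed

subsection \<open>Passing to overalgebras and images\<close>

text \<open>Applied to every \<open>I\<close>, this shows that the ideal of \<open>R\<close>
  generated by \<open>G\<close> lies in the ideal of \<open>S\<close> generated by \<open>G\<close>
  and the products with one factor from \<open>T\<close> on either or both sides, as soon as these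
  lie in \<open>S\<close>.\<close>

lemma ideal_in_cofinite:
  assumes R: "subalg smul R" and S: "subalg smul S" "S \<subseteq> R" and T: "T \<subseteq> R"
    and cof: "\<And>r. r \<in> R \<Longrightarrow> \<exists>s\<in>S. r - s \<in> span T"
    and I: "ideal_in S I" and G: "G \<subseteq> I"
    and TG: "\<And>g t. g \<in> G \<Longrightarrow> t \<in> T \<Longrightarrow> t * g \<in> I"
    and GT: "\<And>g t. g \<in> G \<Longrightarrow> t \<in> T \<Longrightarrow> g * t \<in> I"
    and TGT: "\<And>g t t'. g \<in> G \<Longrightarrow> t \<in> T \<Longrightarrow> t' \<in> T \<Longrightarrow> t * g * t' \<in> I"
  shows "\<exists>J. ideal_in R J \<and> G \<subseteq> J \<and> J \<subseteq> I"
proof (intro exI conjI)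
  note subI = ideal_inD(1)[OF I]
  note sub = subspace_mult_vimage[OF subI]
  \<comment> \<open>The largest ideal of \<open>R\<close> inside \<open>I\<close>. Without a unit,
    the one-sided and the two-sided products are separate conditions.\<close>
  define J where "J = {p \<in> I. \<forall>f\<in>R. f * p \<in> I \<and> p * f \<in> I \<and> (\<forall>h\<in>R. f * p * h \<in> I)}"
  show "J \<subseteq> I" by (auto simp: J_def)
  have split: "\<exists>s t. r = s + t \<and> s \<in> S \<and> t \<in> span T" if "r \<in> R" for r
    using cof[OF that] by (metis add_diff_cancel_left' diff_add_cancel add.commute)
  have left: "t * g \<in> I" if "g \<in> G" "t \<in> span T" for g t
    using that(2) by (rule span_induct) (use sub(2) TG that(1) in auto)
  have right: "g * t \<in> I" if "g \<in> G" "t \<in> span T" for g t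
    using that(2) by (rule span_induct) (use sub(1) GT that(1) in auto)
  have left_right: "t * g * t' \<in> I" if "g \<in> G" "t \<in> span T" "t' \<in> span T" for g t t'
    using that(2)
  proof (rule span_induct)
    show "subspace {t. t * g * t' \<in> I}"
      using sub(2)[of "g * t'"] by (simp add: mult.assoc)
    show "t * g * t' \<in> I" if "t \<in> T" for t
      using \<open>t' \<in> span T\<close>
      by (rule span_induct) (use sub(1)[of "t * g"] TGT \<open>g \<in> G\<close> that in auto)
  qed
  note [simp] = ideal_inD(3,4)[OF I]
  show "G \<subseteq> J"
  proof
    fix g assume g: "g \<in> G"
    then have gI: "g \<in> I" using G by auto
    have 1: "f * g \<in> I" if "f \<in> R" for f
    proof -
      obtain s t where "f = s + t" "s \<in> S" "t \<in> span T" using split[OF \<open>f \<in> R\<close>] by auto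
      then show ?thesis
        using g gI left subspace_add[OF subI] by (simp add: distrib_right)
    qed
    have 2: "g * f \<in> I" if "f \<in> R" for f
    proof -
      obtain s t where "f = s + t" "s \<in> S" "t \<in> span T" using split[OF \<open>f \<in> R\<close>] by auto
      then show ?thesis
        using g gI right subspace_add[OF subI] by (simp add: distrib_left)
    qed
    have 3: "f * g * h \<in> I" if "f \<in> R" "h \<in> R" for f h
    proof -
      obtain s t where f: "f = s + t" "s \<in> S" "t \<in> span T" using split[OF \<open>f \<in> R\<close>] by auto
      obtain s' t' where h: "h = s' + t'" "s' \<in> S" "t' \<in> span T" using split[OF \<open>h \<in> R\<close>] by auto
      \<comment> \<open>Only behind \<open>t\<close> does \<open>h\<close> have to be split:
        \<open>s * (g * h)\<close> lies in \<open>I\<close> by the one-sided case.\<close>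
      have "f * g * h = s * (g * h) + (t * g * s' + t * g * t')"
        by (simp add: f h distrib_left distrib_right mult.assoc)
      then show ?thesis
        using f h g left left_right subspace_add[OF subI] 2[OF \<open>h \<in> R\<close>] by simp
    qed
    show "g \<in> J" using gI 1 2 3 by (auto simp: J_def)
  qed
  have mult: "x * y \<in> R" if "x \<in> R" "y \<in> R" for x y using subalgD(2)[OF R] that .
  show "ideal_in R J"
    unfolding ideal_in_def
  proof (intro conjI ballI)
    show "subspace J"
      using subI unfolding J_def subspace_def
      by (simp add: distrib_left distrib_right flip: smul_mult_left smul_mult_right)
    show "J \<subseteq> R" using ideal_inD(2)[OF I] S by (auto simp: J_def)
    show "s * x \<in> J" if "x \<in> J" "s \<in> R" for x s
      using that mult unfolding J_def by (simp flip: mult.assoc)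
    show "x * s \<in> J" if "x \<in> J" "s \<in> R" for x s
      using that mult unfolding J_def by (simp add: mult.assoc)
  qed
qed

text \<open>Composition of two surjections: the relations are those of \<open>S\<close> together
  with lifts \<open>F\<close> of the generators \<open>E\<close> of the second kernel.\<close>

lemma presents_eval_image:
  assumes pres: "fa.presents Y b H S" and S: "S \<subseteq> fcar X"
    and E: "finite E" "E \<subseteq> S" "\<And>e. e \<in> E \<Longrightarrow> eval a e = 0"
    and ker: "\<And>I p. fa.ideal_in S I \<Longrightarrow> E \<subseteq> I \<Longrightarrow> p \<in> S \<Longrightarrow> eval a p = 0 \<Longrightarrow> p \<in> I"
  shows "\<exists>G. presents Y (\<lambda>i. eval a (b i)) G (eval a ` S)"
proof -
  have Y: "finite Y" and im: "fa.eval b ` fcar Y = S" and H: "finite H" "H \<subseteq> fcar Y"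
    "\<And>h. h \<in> H \<Longrightarrow> fa.eval b h = 0"
    and kerb: "\<And>I p. fa.ideal_in (fcar Y) I \<Longrightarrow> H \<subseteq> I \<Longrightarrow> p \<in> fcar Y \<Longrightarrow> fa.eval b p = 0 \<Longrightarrow> p \<in> I"
    using pres unfolding fa.presents_def by blast+
  have inS: "fa.eval b p \<in> S" if "p \<in> fcar Y" for p using im that by blast
  have comp: "eval (\<lambda>i. eval a (b i)) p = eval a (fa.eval b p)" if "p \<in> fcar Y" for p
  proof -
    have in_X: "fa.eval b q \<in> fcar X" if "q \<in> fcar Y" for q using inS[OF that] S by blast
    have "eval a (fa.eval b p) = eval (\<lambda>i. eval a (b i)) p"
    proof (rule hom_eq_eval[where X = Y and \<phi> = "\<lambda>p. eval a (fa.eval b p)"])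
      show "eval a (b i) = eval a (fa.eval b (word [i]))" if "i \<in> Y" for i
        by (simp add: fa.eval_word)
      show "eval a (fa.eval b (p * q)) = eval a (fa.eval b p) * eval a (fa.eval b q)"
        if "p \<in> fcar Y" "q \<in> fcar Y" for p q
        using fa.eval_mult[OF that, of b] eval_mult[OF in_X in_X] that by simp
    qed (simp_all add: that eval_add eval_scale fa.eval_add fa.eval_scale)
    then show ?thesis by simp
  qed
  obtain F where F: "finite F" "F \<subseteq> fcar Y" "E = fa.eval b ` F"
    using E(1,2) unfolding im[symmetric] by (meson finite_subset_image)
  have "presents Y (\<lambda>i. eval a (b i)) (H \<union> F) (eval a ` S)"
  proof (rule presentsI)
    show "eval (\<lambda>i. eval a (b i)) ` fcar Y = eval a ` S"
      unfolding im[symmetric] image_image by (rule image_cong) (simp_all add: comp)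
    show "eval (\<lambda>i. eval a (b i)) g = 0" if g: "g \<in> H \<union> F" for g
    proof -
      have "g \<in> fcar Y" using g H F by auto
      then show ?thesis using comp[of g] g H(3)[of g] E(3)[of "fa.eval b g"] F(3) eval_zero by auto
    qed
  next
    fix I p assume I: "fa.ideal_in (fcar Y) I" and HF: "H \<union> F \<subseteq> I"
      and p: "p \<in> fcar Y" "eval (\<lambda>i. eval a (b i)) p = 0"
    note IY = fa.ideal_inD(2)[OF I]
    \<comment> \<open>As \<open>fa.eval b\<close> maps onto \<open>S\<close>, it carries ideals to
      ideals, so \<open>ker\<close> applies to the image of \<open>I\<close>. What is lost in
      passing to the image lies in the kernel of \<open>fa.eval b\<close>, which \<open>H\<close>
      forces into \<open>I\<close>.\<close>
    have "fa.ideal_in S (fa.eval b ` I)"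
      unfolding fa.ideal_in_def
    proof (intro conjI ballI)
      show "fa.subspace (fa.eval b ` I)"
        by (rule module_hom.subspace_image[OF fa.module_hom_eval fa.ideal_inD(1)[OF I]])
      show "fa.eval b ` I \<subseteq> S" using inS IY by blast
      fix x s assume "x \<in> fa.eval b ` I" "s \<in> S"
      then obtain q r where q: "q \<in> I" "x = fa.eval b q" and r: "r \<in> fcar Y" "s = fa.eval b r"
        using im by blast
      have "q \<in> fcar Y" using q IY by blast
      then have "s * x = fa.eval b (r * q)" "x * s = fa.eval b (q * r)"
        using fa.eval_mult[of _ Y _ b] q r by auto
      then show "s * x \<in> fa.eval b ` I" "x * s \<in> fa.eval b ` I"
        using fa.ideal_inD(3,4)[OF I] q r by blast+
    qed
    moreover have "E \<subseteq> fa.eval b ` I" using F HF by blast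
    ultimately have "fa.eval b p \<in> fa.eval b ` I"
      using ker[of "fa.eval b ` I" "fa.eval b p"] inS[OF p(1)] p(2) comp[OF p(1)] by simp
    then obtain q where q: "q \<in> I" "fa.eval b p = fa.eval b q" by blast
    have "p - q \<in> I"
      using p(1) q IY HF
      by (intro kerb[OF I]) (auto simp: fa.eval_diff intro: fa.subspace_diff[OF subspace_fcar])
    then have "p - q + q \<in> I" using q fa.subspace_add[OF fa.ideal_inD(1)[OF I]] by blast
    then show "p \<in> I" by simp
  qed (use Y H F in auto)
  then show ?thesis by blast
qed

lemma presents_extend:
  assumes noeth: "noetherian_cring TYPE('k)"
    and pres: "presents X a G B" and B: "subalg smul B"
    and T: "finite T" and cof: "\<And>x. \<exists>b\<in>B. x - b \<in> span T"
  shows "\<exists>X' a' G'. presents X' a' G' UNIV"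
proof -
  have X: "finite X" and im: "eval a ` fcar X = B" and G: "finite G" "G \<subseteq> fcar X"
    "\<And>g. g \<in> G \<Longrightarrow> eval a g = 0"
    and ker: "\<And>I p. fa.ideal_in (fcar X) I \<Longrightarrow> G \<subseteq> I \<Longrightarrow> p \<in> fcar X \<Longrightarrow> eval a p = 0 \<Longrightarrow> p \<in> I"
    using pres unfolding presents_def by blast+
  obtain N where N: "X \<subseteq> {..<N}" using X finite_nat_set_iff_bounded by (metis lessThan_iff subsetI)
  obtain h n where h: "T = h ` {i::nat. i < n}"
    using finite_imp_nat_seg_image_inj_on[OF T] by blast
  \<comment> \<open>The new letters start at \<open>N\<close>, above all of \<open>X\<close>, so
    that \<open>a'\<close> can extend \<open>a\<close>.\<close>
  define Z where "Z = (\<lambda>i. i + N) ` {i. i < n}"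
  define a' where "a' i = (if i < N then a i else h (i - N))" for i
  have "a' (i + N) = h i" for i by (simp add: a'_def)
  then have aZ: "a' ` Z = T" by (simp add: Z_def h image_image)
  have finZ: "finite Z" by (simp add: Z_def)
  define X' where "X' = X \<union> Z"
  have XX': "fcar X \<subseteq> (fcar X' :: 'k fa set)" by (rule fcar_mono) (simp add: X'_def)
  have eval_X: "eval a' p = eval a p" if "p \<in> fcar X" for p
    using that by (rule eval_cong) (use N in \<open>auto simp: a'_def\<close>)
  define L :: "'k fa set" where "L = fa.span ((\<lambda>t. word [t]) ` Z)"
  have LX: "L \<subseteq> fcar X'"
    unfolding L_def by (rule fa.span_minimal) (auto simp: X'_def subspace_fcar intro: word_in_fcar)
  have evL: "eval a' ` L = span T"
    unfolding L_def module_hom.span_image[OF module_hom_eval, symmetric]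
    by (simp add: image_image eval_word aZ)
  define M where "M = {p + l |p l. p \<in> fcar X \<and> l \<in> L}"
  have subM: "fa.subspace M"
    unfolding M_def by (rule fa.subspace_plus) (simp_all add: subspace_fcar L_def)
  have MX: "M \<subseteq> fcar X'"
    using XX' LX fa.subspace_add[OF subspace_fcar[of X']] unfolding M_def by blast
  have XM: "fcar X \<subseteq> M"
    unfolding M_def using fa.subspace_0[of L] by (force simp: L_def)
  have LM: "L \<subseteq> M"
    unfolding M_def using fa.subspace_0[OF subspace_fcar[of X]] by force
  have "\<exists>m\<in>M. eval a' m = x" for x
  proof -
    obtain b where "b \<in> B" "x - b \<in> span T" using cof by blast
    then obtain p l where "p \<in> fcar X" "eval a p = b" "l \<in> L" "eval a' l = x - b"
      using im evL by (metis imageE)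
    then show ?thesis
      by (intro bexI[of _ "p + l"]) (auto simp: M_def eval_add eval_X)
  qed
  then obtain \<mu> where \<mu>: "\<mu> x \<in> M" "eval a' (\<mu> x) = x" for x by metis
  \<comment> \<open>Two sums p + l of equal value, with p in \<open>fcar X\<close> and l in
    \<open>L\<close>, have linear parts that differ by an element of \<open>K\<close>. So generators
    of \<open>K\<close> account for every coincidence of values.\<close>
  define K where "K = {l \<in> L. eval a' l \<in> B}"
  have "fa.subspace K"
  proof -
    have "fa.subspace {l. eval a' l \<in> B}"
      by (rule module_hom.subspace_linear_preimage[OF module_hom_eval subalgD(1)[OF B]])
    then have "fa.subspace (L \<inter> {l. eval a' l \<in> B})"
      by (intro fa.subspace_inter) (simp_all add: L_def)
    then show ?thesis by (simp add: K_def Int_def)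
  qed
  then obtain Gk where Gk: "finite Gk" "fa.span Gk = K"
    using fa.submodule_fg[OF noeth, of "(\<lambda>t. word [t]) ` Z" K] finZ
    by (auto simp: K_def L_def)
  have "\<exists>p\<in>fcar X. eval a' p = eval a' g" if "g \<in> Gk" for g
  proof -
    have "eval a' g \<in> B" using fa.span_base[OF that] Gk by (simp add: K_def)
    then show ?thesis using im eval_X by (metis imageE)
  qed
  then obtain \<kappa> where \<kappa>: "\<kappa> g \<in> fcar X" "eval a' (\<kappa> g) = eval a' g" if "g \<in> Gk" for g
    by metis
  define rel where "rel = (\<lambda>(i, j). word [i] * word [j] - \<mu> (eval a' (word [i] * word [j])))"
  define G' where "G' = G \<union> rel ` (X' \<times> X') \<union> (\<lambda>g. g - \<kappa> g) ` Gk"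
  have "presents X' a' G' UNIV"
  proof (rule presentsI)
    show "finite X'" by (simp add: X'_def X finZ)
    show "eval a' ` fcar X' = UNIV" using \<mu> MX by (metis UNIV_eq_I imageI subsetD)
    show "finite G'" by (simp add: G'_def G Gk X finZ X'_def)
    have "Gk \<subseteq> fcar X'" using fa.span_superset[of Gk] Gk LX by (auto simp: K_def)
    moreover have "rel ij \<in> fcar X'" if "ij \<in> X' \<times> X'" for ij
      using that \<mu>(1) MX unfolding rel_def
      by (auto simp: word_mult intro!: fa.subspace_diff[OF subspace_fcar] word_in_fcar)
    ultimately show "G' \<subseteq> fcar X'"
      unfolding G'_def using G XX' \<kappa>(1)
      by (auto intro!: fa.subspace_diff[OF subspace_fcar])
    show "eval a' g = 0" if "g \<in> G'" for g
      using that G \<kappa>(2) \<mu>(2) unfolding G'_def rel_def by (auto simp: eval_diff eval_X subset_iff)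
  next
    fix I p assume I: "fa.ideal_in (fcar X') I" and GI: "G' \<subseteq> I"
      and Iker: "\<And>q. q \<in> I \<Longrightarrow> eval a' q = 0"
      and p: "p \<in> fcar X'" "eval a' p = 0"
    note subI = fa.ideal_inD(1)[OF I]
    \<comment> \<open>The aim is \<open>fcar X' \<subseteq> MI\<close>, for which closure of
      \<open>MI\<close> under left multiplication by letters is enough.\<close>
    define MI where "MI = {m + q |m q. m \<in> M \<and> q \<in> I}"
    have subMI: "fa.subspace MI"
      unfolding MI_def using subM subI by (rule fa.subspace_plus)
    have M_MI: "M \<subseteq> MI" unfolding MI_def using fa.subspace_0[OF subI] by force
    have I_MI: "I \<subseteq> MI" unfolding MI_def using fa.subspace_0[OF subM] by force
    have pair: "word [i, j] \<in> MI" if "i \<in> X'" "j \<in> X'" for i j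
    proof -
      have "rel (i, j) \<in> I" using that GI by (auto simp: G'_def)
      then have "\<mu> (eval a' (word [i] * word [j])) + rel (i, j) \<in> MI"
        unfolding MI_def using \<mu>(1) by blast
      then show ?thesis by (simp add: rel_def word_mult)
    qed
    \<comment> \<open>Rewriting t x leaves a linear form in several new letters in front of the
      shorter word \<open>w\<close>; hence \<open>t\<close> is arbitrary in the induction.\<close>
    have ZX: "word (t # w) \<in> MI" if "w \<noteq> []" "set w \<subseteq> X" "t \<in> Z" for t w
      using that
    proof (induction w arbitrary: t rule: list_nonempty_induct)
      case (single x)
      then show ?case using pair[of t x] by (auto simp: X'_def)
    next
      case (cons x w)
      have "word [t, x] \<in> MI" using cons.prems by (intro pair) (auto simp: X'_def)
      then obtain p l q where e: "word [t, x] = p + l + q" "p \<in> fcar X" "l \<in> L" "q \<in> I"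
        unfolding MI_def M_def by blast
      have w: "word w \<in> fcar X" using cons by (auto intro: word_in_fcar)
      have "l * word w \<in> MI"
        using \<open>l \<in> L\<close> unfolding L_def
      proof (rule fa.span_induct)
        show "fa.subspace {l. l * word w \<in> MI}" by (rule fa.subspace_mult_vimage[OF subMI])
        show "l * word w \<in> MI" if "l \<in> (\<lambda>t. word [t]) ` Z" for l
          using that cons by (auto simp: word_mult)
      qed
      moreover have "p * word w \<in> MI" using fcar_mult[OF e(2) w] XM M_MI by blast
      moreover have "q * word w \<in> MI" using fa.ideal_inD(4)[OF I e(4)] w XX' I_MI by blast
      ultimately have "word [t, x] * word w \<in> MI"
        unfolding e(1) distrib_right using fa.subspace_add[OF subMI] by blast
      then show ?case by (simp add: word_mult)
    qed
    have step: "word [i] * u \<in> MI" if i: "i \<in> X'" and "u \<in> MI" for i u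
    proof -
      obtain p l q where u: "u = p + l + q" "p \<in> fcar X" "l \<in> L" "q \<in> I"
        using \<open>u \<in> MI\<close> unfolding MI_def M_def by blast
      have "word [i] * l \<in> MI"
        using \<open>l \<in> L\<close> unfolding L_def
      proof (rule fa.span_induct)
        show "fa.subspace {l. word [i] * l \<in> MI}" by (rule fa.subspace_mult_vimage[OF subMI])
        show "word [i] * l \<in> MI" if "l \<in> (\<lambda>t. word [t]) ` Z" for l
          using that pair i by (auto simp: word_mult X'_def)
      qed
      moreover have "word [i] * p \<in> MI"
      proof (cases "i \<in> X")
        case True
        then show ?thesis using fcar_mult[OF word_in_fcar u(2), of "[i]"] XM M_MI by auto
      next
        case False
        then have "i \<in> Z" using i by (simp add: X'_def)
        from u(2) show ?thesis
          by (induction p rule: fcar_induct)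
            (use ZX \<open>i \<in> Z\<close> fa.subspace_mult_vimage[OF subMI] in \<open>auto simp: word_mult\<close>)
      qed
      moreover have "word [i] * q \<in> MI"
        using fa.ideal_inD(3)[OF I u(4) word_in_fcar[of "[i]"]] i I_MI by auto
      ultimately show ?thesis
        unfolding u(1) distrib_left using fa.subspace_add[OF subMI] by blast
    qed
    from p(1) have "p \<in> MI"
    proof (induction p rule: fcar_induct)
      case subspace
      then show ?case using subMI by simp
    next
      case (word w)
      then show ?case
      proof (induction w rule: list_nonempty_induct)
        case (single i)
        show ?case
        proof (cases "i \<in> X")
          case True
          then show ?thesis using word_in_fcar[of "[i]" X] XM M_MI by auto
        next
          case False
          then have "word [i] \<in> L"
            using single by (auto simp: X'_def L_def intro: fa.span_base)
          then show ?thesis using LM M_MI by blast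
        qed
      next
        case (cons i w)
        then show ?case using step[of i "word w"] by (simp add: word_mult)
      qed
    qed
    then obtain p1 l q where e: "p = p1 + l + q" "p1 \<in> fcar X" "l \<in> L" "q \<in> I"
      unfolding MI_def M_def by blast
    have ev: "eval a' p1 + eval a' l = 0"
      using p(2) Iker[OF e(4)] unfolding e(1) by (simp add: eval_add)
    have "eval a' p1 \<in> B" using e(2) eval_X im by auto
    then have "eval a' l \<in> B"
      using ev subspace_neg[OF subalgD(1)[OF B]] by (metis add_eq_0_iff)
    then have "l \<in> fa.span Gk" using e(3) Gk by (simp add: K_def)
    \<comment> \<open>Trades the linear form for an element of \<open>fcar X\<close> modulo
      \<open>I\<close>; what remains is a relation of \<open>B\<close>.\<close>
    then have "l \<in> {p + q |p q. p \<in> fcar X \<and> q \<in> I}"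
    proof (rule fa.span_induct)
      have "fa.subspace {p + q |p q. p \<in> fcar X \<and> q \<in> I}"
        using subspace_fcar subI by (rule fa.subspace_plus)
      then show "fa.subspace {l. l \<in> {p + q |p q. p \<in> fcar X \<and> q \<in> I}}" by simp
      show "g \<in> {p + q |p q. p \<in> fcar X \<and> q \<in> I}" if "g \<in> Gk" for g
      proof -
        have "g = \<kappa> g + (g - \<kappa> g)" "g - \<kappa> g \<in> I" using that GI by (auto simp: G'_def)
        then show ?thesis using \<kappa>(1)[OF that] by blast
      qed
    qed
    then obtain p2 q2 where l: "l = p2 + q2" "p2 \<in> fcar X" "q2 \<in> I" by blast
    have in_X: "p1 + p2 \<in> fcar X" using e l fa.subspace_add[OF subspace_fcar] by blast
    have "eval a (p1 + p2) = 0"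
      using ev Iker[OF l(3)] eval_X[OF in_X] unfolding l(1) by (simp add: eval_add)
    moreover have "fa.ideal_in (fcar X) (I \<inter> fcar X)"
      using subI subspace_fcar[of X] fa.ideal_inD(3,4)[OF I] XX' unfolding fa.ideal_in_def
      by (intro conjI ballI fa.subspace_inter IntI fcar_mult) auto
    moreover have "G \<subseteq> I \<inter> fcar X" using GI G by (auto simp: G'_def)
    ultimately have "p1 + p2 \<in> I" using ker[of "I \<inter> fcar X" "p1 + p2"] in_X by simp
    then have "(p1 + p2) + q2 + q \<in> I"
      using l e fa.subspace_add[OF subI] by blast
    then show "p \<in> I" by (simp add: e l add.assoc)
  qed
  then show ?thesis by blast
qed

end

subsection \<open>Subalgebras of free algebras\<close>

definition lcomb :: "('i \<Rightarrow> 'a::ring) \<Rightarrow> 'i set \<Rightarrow> 'a set \<Rightarrow> 'a set" where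
  "lcomb g W F = {\<Sum>w\<in>W. g w * f w |f. \<forall>w\<in>W. f w \<in> F}"

lemma mult_in_lcomb:
  assumes "finite W" "w \<in> W" "0 \<in> F" "x \<in> F"
  shows "g w * x \<in> lcomb g W F"
proof -
  have "(\<Sum>v\<in>W. g v * (if v = w then x else 0)) = g w * x"
    using assms by (simp add: if_distrib cong: if_cong)
  then show ?thesis
    unfolding lcomb_def using assms by (force intro!: exI[of _ "\<lambda>v. if v = w then x else 0"])
qed

lemma (in k_algebra) subspace_lcomb:
  assumes "subspace F"
  shows "subspace (lcomb g W F)"
  unfolding subspace_def
proof (intro conjI ballI allI)
  show "0 \<in> lcomb g W F"
    unfolding lcomb_def using subspace_0[OF assms] by (force intro!: exI[of _ "\<lambda>_. 0"])
next
  fix x y assume "x \<in> lcomb g W F" "y \<in> lcomb g W F"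
  then obtain f f' where "x = (\<Sum>w\<in>W. g w * f w)" "y = (\<Sum>w\<in>W. g w * f' w)"
    "\<forall>w\<in>W. f w \<in> F" "\<forall>w\<in>W. f' w \<in> F"
    unfolding lcomb_def by blast
  then show "x + y \<in> lcomb g W F"
    unfolding lcomb_def using subspace_add[OF assms]
    by (auto intro!: exI[of _ "\<lambda>w. f w + f' w"] simp: distrib_left sum.distrib)
next
  fix c x assume "x \<in> lcomb g W F"
  then obtain f where "x = (\<Sum>w\<in>W. g w * f w)" "\<forall>w\<in>W. f w \<in> F"
    unfolding lcomb_def by blast
  then show "smul c x \<in> lcomb g W F"
    unfolding lcomb_def using subspace_scale[OF assms]
    by (auto intro!: exI[of _ "\<lambda>w. smul c (f w)"] simp: scale_sum_right smul_mult_right)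
qed

section \<open>Degrees in the free algebra\<close>

definition fdeg :: "nat set \<Rightarrow> nat \<Rightarrow> 'k::comm_ring_1 fa set" where
  "fdeg X d = {p \<in> fcar X. \<forall>w\<in>supp p. length w \<le> d}"

lemma fdeg_eq_span: "fdeg X d = fa.span (word ` {w. w \<noteq> [] \<and> set w \<subseteq> X \<and> length w \<le> d})"
  unfolding span_words fdeg_def fcar_def by auto

lemma subspace_fdeg: "fa.subspace (fdeg X d)"
  unfolding fdeg_eq_span by (rule fa.subspace_span)

lemma fdeg_subset_fcar: "fdeg X d \<subseteq> fcar X"
  by (auto simp: fdeg_def)

lemma fdeg_mono: "d \<le> e \<Longrightarrow> fdeg X d \<subseteq> fdeg X e"
  by (auto simp: fdeg_def)

lemma word_in_fdeg: "w \<noteq> [] \<Longrightarrow> set w \<subseteq> X \<Longrightarrow> length w \<le> d \<Longrightarrow> word w \<in> fdeg X d"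
  unfolding fdeg_eq_span by (intro fa.span_base) auto

lemma fcar_in_fdeg:
  assumes "p \<in> fcar X"
  shows "\<exists>d. p \<in> fdeg X d"
proof -
  have "\<forall>w\<in>supp p. length w \<le> Max (length ` supp p)" by simp
  then show ?thesis using assms unfolding fdeg_def by blast
qed

lemma fdeg_mult:
  fixes p q :: "'k::comm_ring_1 fa"
  assumes "p \<in> fdeg X d" "q \<in> fdeg X e"
  shows "p * q \<in> fdeg X (d + e)"
  using assms(1) unfolding fdeg_eq_span[of X d]
proof (rule fa.span_induct)
  show "fa.subspace {p. p * q \<in> fdeg X (d + e)}"
    by (rule fa.subspace_mult_vimage[OF subspace_fdeg])
  fix p :: "'k fa" assume "p \<in> word ` {w. w \<noteq> [] \<and> set w \<subseteq> X \<and> length w \<le> d}"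
  then obtain u where u: "p = word u" "u \<noteq> []" "set u \<subseteq> X" "length u \<le> d" by blast
  show "p * q \<in> fdeg X (d + e)"
    using assms(2) unfolding fdeg_eq_span[of X e]
  proof (rule fa.span_induct)
    show "fa.subspace {q. p * q \<in> fdeg X (d + e)}"
      by (rule fa.subspace_mult_vimage[OF subspace_fdeg])
  qed (use u in \<open>force simp: word_mult intro!: word_in_fdeg\<close>)
qed

lemma fdeg_submodule_fg:
  fixes S :: "'k::comm_ring_1 fa set"
  assumes "noetherian_cring TYPE('k)" "finite X" "fa.subspace S" "S \<subseteq> fdeg X d"
  shows "\<exists>G. finite G \<and> G \<subseteq> S \<and> fa.span G = S"
proof (rule fa.submodule_fg)
  have "finite {w. set w \<subseteq> X \<and> length w \<le> d}"
    using assms(2) by (rule finite_lists_length_le)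
  then show "finite (word ` {w. w \<noteq> [] \<and> set w \<subseteq> X \<and> length w \<le> d})"
    by (rule finite_imageI[OF finite_subset[rotated]]) auto
qed (use assms in \<open>auto simp: fdeg_eq_span\<close>)

text \<open>The filtration Q(d): prescribed up to degree N, generated from the left by the \<open>g w\<close> (of
  degree m) above. The case m = 0 only serves termination.\<close>
function filt :: "(nat \<Rightarrow> 'a::ring set) \<Rightarrow> nat \<Rightarrow> nat \<Rightarrow> ('i \<Rightarrow> 'a) \<Rightarrow> 'i set \<Rightarrow> nat \<Rightarrow> 'a set" where
  "filt A N m g W d = (if d \<le> N \<or> m = 0 then A d
     else {p + q |p q. p \<in> lcomb g W (filt A N m g W (d - m)) \<and> q \<in> filt A N m g W (d - 1)})"
  by auto
termination by (relation "Wellfounded.measure (\<lambda>(A, N, m, g, W, d). d)") auto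

declare filt.simps [simp del]

text \<open>In a word of length d the first n + 1 letters give way to \<open>r w\<close> and the
  remaining ones to an element of \<open>B\<close>; both replacements change only terms of degree
  below d.\<close>

lemma cofinite_decomp:
  assumes "finite X" and B: "subalg fscale B" "B \<subseteq> fcar X"
    and cof: "\<And>p. p \<in> fcar X \<Longrightarrow> \<exists>b\<in>B. p - b \<in> fdeg X n"
    and W: "W = {w. set w \<subseteq> X \<and> length w = Suc n}"
    and r: "\<And>w. w \<in> W \<Longrightarrow> r w \<in> B" "\<And>w. w \<in> W \<Longrightarrow> word w - r w \<in> fdeg X n"
    and rm: "\<And>w. w \<in> W \<Longrightarrow> r w \<in> fdeg X (Suc n)"
    and d: "d > 2 * n + 1" and u: "u \<in> fdeg X d"
  shows "\<exists>p\<in>lcomb r W (B \<inter> fdeg X (d - Suc n)). u - p \<in> fdeg X (d - 1)"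
proof -
  have finW: "finite W" unfolding W using \<open>finite X\<close> by (rule finite_lists_length_eq)
  let ?Bd = "B \<inter> fdeg X (d - Suc n)"
  have subB: "fa.subspace ?Bd"
    using fa.subalgD(1)[OF B(1)] subspace_fdeg by (rule fa.subspace_inter)
  let ?S = "{p + q |p q. p \<in> lcomb r W ?Bd \<and> q \<in> fdeg X (d - 1)}"
  have subL: "fa.subspace (lcomb r W ?Bd)" using subB by (rule fa.subspace_lcomb)
  then have sub: "fa.subspace ?S" using subspace_fdeg by (rule fa.subspace_plus)
  have "word v \<in> ?S" if v: "v \<noteq> []" "set v \<subseteq> X" "length v \<le> d" for v
  proof (cases "length v = d")
    case False
    then have "word v \<in> fdeg X (d - 1)" using v by (intro word_in_fdeg) auto
    then show ?thesis using fa.subspace_0[OF subL] by force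
  next
    case True
    define w v' where "w = take (Suc n) v" and "v' = drop (Suc n) v"
    have v': "v' \<noteq> []" "set v' \<subseteq> X" "length v' = d - Suc n"
      using True d v(2) set_drop_subset[of "Suc n" v] by (auto simp: v'_def)
    have w: "w \<in> W" using True d v(2) set_take_subset[of "Suc n" v] by (auto simp: w_def W)
    have wv: "word v = word w * word v'" by (simp add: w_def v'_def word_mult)
    obtain b where b: "b \<in> B" "word v' - b \<in> fdeg X n" using cof word_in_fcar v' by blast
    have v'd: "word v' \<in> fdeg X (d - Suc n)" using v' by (intro word_in_fdeg) auto
    have "word v' - b \<in> fdeg X (d - Suc n)"
    proof -
      have "n \<le> d - Suc n" using d by simp
      then show ?thesis using b(2) fdeg_mono[of n "d - Suc n" X] by blast
    qed
    from fa.subspace_diff[OF subspace_fdeg v'd this] have bB: "b \<in> ?Bd" using b(1) by simp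
    \<comment> \<open>The two errors: the first loses degree in the prefix; the second has degree at
      most (n + 1) + n, which is below d because d > 2 n + 1.\<close>
    have "(word w - r w) * word v' \<in> fdeg X (d - 1)"
      using fdeg_mult[OF r(2)[OF w] v'd] d by simp
    moreover have "r w * (word v' - b) \<in> fdeg X (d - 1)"
    proof -
      have "Suc n + n \<le> d - 1" using d by simp
      then show ?thesis using fdeg_mult[OF rm[OF w] b(2)] fdeg_mono[of "Suc n + n" "d - 1" X] by blast
    qed
    ultimately have "(word w - r w) * word v' + r w * (word v' - b) \<in> fdeg X (d - 1)"
      by (rule fa.subspace_add[OF subspace_fdeg])
    moreover have "r w * b \<in> lcomb r W ?Bd"
      using mult_in_lcomb[OF finW w _ bB] fa.subspace_0[OF subB] by auto
    moreover have "word v = r w * b + ((word w - r w) * word v' + r w * (word v' - b))"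
      by (simp add: wv algebra_simps)
    ultimately show ?thesis by blast
  qed
  then have "fdeg X d \<subseteq> ?S"
    unfolding fdeg_eq_span[of X d] by (intro fa.span_minimal[OF _ sub]) blast
  then obtain p q where "u = p + q" "p \<in> lcomb r W ?Bd" "q \<in> fdeg X (d - 1)" using u by blast
  then show ?thesis by (intro bexI[of _ p]) auto
qed

text \<open>The downward direction for A = K<X>, where leading words are available.\<close>

lemma cofinite_subalg_presented:
  fixes B :: "'k::comm_ring_1 fa set"
  assumes noeth: "noetherian_cring TYPE('k)" and finX: "finite X"
    and B: "subalg fscale B" "B \<subseteq> fcar X"
    and cof: "\<And>p. p \<in> fcar X \<Longrightarrow> \<exists>b\<in>B. p - b \<in> fdeg X n"
  shows "\<exists>Y b H. fa.presents Y b H B"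
proof -
  \<comment> \<open>\<open>N = m + n\<close> is the threshold of \<open>cofinite_decomp\<close>.
    Moreover \<open>m \<le> N\<close>, so each \<open>r w\<close> has low enough degree to be the
    value of a linear form.\<close>
  define m N where "m = Suc n" and "N = 2 * n + 1"
  define W where "W = {w. set w \<subseteq> X \<and> length w = m}"
  have finW: "finite W" unfolding W_def using finX by (rule finite_lists_length_eq)
  have word_W: "word w \<in> fdeg X m" if "w \<in> W" for w
    using that by (intro word_in_fdeg) (auto simp: W_def m_def)
  have "\<exists>b\<in>B. word w - b \<in> fdeg X n" if "w \<in> W" for w
    using cof word_W[OF that] fdeg_subset_fcar by blast
  then obtain r where r: "r w \<in> B" "word w - r w \<in> fdeg X n" if "w \<in> W" for w by metis
  have rm: "r w \<in> fdeg X m" if w: "w \<in> W" for w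
  proof -
    have "word w - r w \<in> fdeg X m" using r(2)[OF w] fdeg_mono[of n m X] by (auto simp: m_def)
    from fa.subspace_diff[OF subspace_fdeg word_W[OF w] this] show ?thesis by simp
  qed
  note subB = fa.subalgD(1)[OF B(1)]
  define D where "D d = B \<inter> fdeg X d" for d
  have subD: "fa.subspace (D d)" for d
    unfolding D_def using subB subspace_fdeg by (rule fa.subspace_inter)
  have D_mono: "D d \<subseteq> D e" if "d \<le> e" for d e
    using fdeg_mono[OF that, of X] by (auto simp: D_def)
  have rD: "r w * x \<in> D (d + m)" if "w \<in> W" "x \<in> D d" for w x d
    using that r(1) fa.subalgD(2)[OF B(1)] fdeg_mult[OF rm, of w x d]
    by (auto simp: D_def add.commute)
  have decomp: "\<exists>p\<in>lcomb r W (D (d - m)). u - p \<in> D (d - 1)" if d: "d > N" and u: "u \<in> D d" for d u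
  proof -
    obtain p where p: "p \<in> lcomb r W (D (d - m))" "u - p \<in> fdeg X (d - 1)"
      using cofinite_decomp[OF finX B cof, where W = W and r = r and d = d and u = u] W_def r rm d u
      by (auto simp: D_def N_def m_def)
    obtain f where f: "p = (\<Sum>w\<in>W. r w * f w)" "\<forall>w\<in>W. f w \<in> D (d - m)"
      using p(1) unfolding lcomb_def by blast
    have "p \<in> B"
      unfolding f(1) using f(2) r(1) fa.subalgD(2)[OF B(1)]
      by (intro fa.subspace_sum[OF subB]) (auto simp: D_def)
    then have "u - p \<in> B" using u fa.subspace_diff[OF subB] by (auto simp: D_def)
    then show ?thesis using p by (auto simp: D_def)
  qed

  obtain T where T: "finite T" "fa.span T = D N"
    using fdeg_submodule_fg[OF noeth finX subD, of N N] by (auto simp: D_def)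
  obtain b k where b: "T = b ` {i::nat. i < k}"
    using finite_imp_nat_seg_image_inj_on[OF T(1)] by blast
  define Y where "Y = {i. i < k}"
  have bY: "b ` Y = T" by (simp add: b Y_def)
  define V :: "'k fa set" where "V = (\<lambda>i. word [i]) ` Y"
  have finV: "finite V" by (simp add: V_def Y_def)
  \<comment> \<open>The linear forms in the letters of \<open>Y\<close>: a finitely generated
    module, so all its submodules are finitely generated.\<close>
  define L where "L = fa.span V"
  define \<pi> where "\<pi> = fa.eval b"
  have hom: "module_hom fscale fscale \<pi>" unfolding \<pi>_def by (rule fa.module_hom_eval)
  note \<pi>_simps = module_hom.add[OF hom] module_hom.diff[OF hom] module_hom.zero[OF hom]
    module_hom.sum[OF hom]
  have LY: "L \<subseteq> fcar Y"
    unfolding L_def V_def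
    by (rule fa.span_minimal) (auto simp: subspace_fcar intro: word_in_fcar)
  have subL: "fa.subspace L" by (simp add: L_def)
  have \<pi>L: "\<pi> ` L = D N"
    unfolding L_def V_def module_hom.span_image[OF hom, symmetric] T(2)[symmetric] bY[symmetric]
    by (simp add: image_image \<pi>_def fa.eval_word)
  have bB: "b ` Y \<subseteq> B" using bY T fa.span_superset[of T] by (auto simp: D_def)
  have \<pi>B: "\<pi> p \<in> B" if "p \<in> fcar Y" for p
    unfolding \<pi>_def using B(1) bB that by (rule fa.eval_in_subalg)
  have \<pi>_mult: "\<pi> (p * q) = \<pi> p * \<pi> q" if "p \<in> fcar Y" "q \<in> fcar Y" for p q
    unfolding \<pi>_def using that by (rule fa.eval_mult)
  have "\<exists>l\<in>L. \<pi> l = x" if "x \<in> D N" for x using \<pi>L that by (metis imageE)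
  then obtain \<nu> where \<nu>: "\<nu> x \<in> L" "\<pi> (\<nu> x) = x" if "x \<in> D N" for x by metis
  define \<rho> where "\<rho> w = \<nu> (r w)" for w
  have "r w \<in> D N" if "w \<in> W" for w
    using r(1) rm fdeg_mono[of m N X] that by (auto simp: D_def m_def N_def)
  then have \<rho>: "\<rho> w \<in> L" "\<pi> (\<rho> w) = r w" if "w \<in> W" for w
    using \<nu> that by (auto simp: \<rho>_def)
  have \<rho>Y: "\<rho> w \<in> fcar Y" if "w \<in> W" for w using \<rho>(1)[OF that] LY by blast

  \<comment> \<open>Up to \<open>N\<close> the condition on a linear form is the degree of its
    image, so that \<open>Q N\<close> is all of \<open>L\<close>. Above \<open>N\<close> an image of
    small degree is not enough: membership demands an expression of the recursive shape.\<close>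
  define Q where "Q = filt (\<lambda>d. {l \<in> L. \<pi> l \<in> fdeg X d}) N m \<rho> W"
  have Q_low: "Q d = {l \<in> L. \<pi> l \<in> fdeg X d}" if "d \<le> N" for d
    unfolding Q_def by (subst filt.simps) (simp add: that)
  have Q_high: "Q d = {p + q |p q. p \<in> lcomb \<rho> W (Q (d - m)) \<and> q \<in> Q (d - 1)}" if "d > N" for d
    unfolding Q_def by (subst filt.simps) (use that in \<open>simp add: m_def\<close>)
  have Q_N: "Q N = L"
    using \<pi>L by (auto simp: Q_low D_def)
  have subQ: "fa.subspace (Q d)" for d
  proof (induction d rule: less_induct)
    case (less d)
    show ?case
    proof (cases "d \<le> N")
      case True
      have "fa.subspace (L \<inter> {l. \<pi> l \<in> fdeg X d})"
        using subL module_hom.subspace_linear_preimage[OF hom subspace_fdeg]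
        by (rule fa.subspace_inter)
      then show ?thesis using True by (simp add: Q_low Int_def)
    next
      case False
      then have "fa.subspace (Q (d - m))" "fa.subspace (Q (d - 1))"
        using less.IH by (auto simp: m_def)
      then show ?thesis
        using False fa.subspace_plus[OF fa.subspace_lcomb] by (simp add: Q_high)
    qed
  qed
  have Q_Suc: "Q d \<subseteq> Q (Suc d)" for d
  proof (cases "Suc d \<le> N")
    case True
    then show ?thesis using fdeg_mono[of d "Suc d" X] by (auto simp: Q_low)
  next
    case False
    have "0 \<in> lcomb \<rho> W (Q (Suc d - m))"
      using fa.subspace_0[OF fa.subspace_lcomb[OF subQ]] .
    then show ?thesis using False Q_high[of "Suc d"] by force
  qed
  then have Q_mono: "Q d \<subseteq> Q e" if "d \<le> e" for d e
    using that by (rule lift_Suc_mono_le)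
  have QY: "Q d \<subseteq> fcar Y" for d
  proof (induction d rule: less_induct)
    case (less d)
    show ?case
    proof (cases "d \<le> N")
      case True
      then show ?thesis using LY by (auto simp: Q_low)
    next
      case False
      have "Q (d - m) \<subseteq> fcar Y" using less.IH[of "d - m"] False by (simp add: m_def)
      then have "\<rho> w * x \<in> fcar Y" if "w \<in> W" "x \<in> Q (d - m)" for w x
        using that \<rho>Y fcar_mult by blast
      then have "lcomb \<rho> W (Q (d - m)) \<subseteq> fcar Y"
        unfolding lcomb_def by (auto intro!: fa.subspace_sum[OF subspace_fcar])
      moreover have "Q (d - 1) \<subseteq> fcar Y" using less.IH False by auto
      ultimately show ?thesis
        using False fa.subspace_add[OF subspace_fcar[of Y]] by (force simp: Q_high)
    qed
  qed
  have \<pi>_lcomb: "\<pi> (\<Sum>w\<in>W. \<rho> w * f w) = (\<Sum>w\<in>W. r w * \<pi> (f w))"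
    if "\<And>w. w \<in> W \<Longrightarrow> f w \<in> fcar Y" for f
    using that by (simp add: \<pi>_simps \<pi>_mult \<rho>Y \<rho>(2) cong: sum.cong)
  \<comment> \<open>Surjectivity above \<open>N\<close> is \<open>decomp\<close> lifted along
    \<open>\<pi>\<close>; the other inclusion counts degrees.\<close>
  have \<pi>Q: "\<pi> ` Q d = D d" for d
  proof (induction d rule: less_induct)
    case (less d)
    show ?case
    proof (cases "d \<le> N")
      case True
      then have "D d \<subseteq> \<pi> ` L" using \<pi>L D_mono by blast
      then show ?thesis using True LY \<pi>B by (auto simp: Q_low D_def)
    next
      case False
      have IH: "\<pi> ` Q (d - m) = D (d - m)" "\<pi> ` Q (d - 1) = D (d - 1)"
        using less.IH False by (auto simp: m_def)
      have dm: "d - m + m = d" using False by (simp add: m_def N_def)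
      show ?thesis
      proof
        show "\<pi> ` Q d \<subseteq> D d"
        proof
          fix x assume "x \<in> \<pi> ` Q d"
          then obtain f q where x: "x = \<pi> ((\<Sum>w\<in>W. \<rho> w * f w) + q)"
            "\<forall>w\<in>W. f w \<in> Q (d - m)" "q \<in> Q (d - 1)"
            using False by (auto simp: Q_high lcomb_def)
          have "x = (\<Sum>w\<in>W. r w * \<pi> (f w)) + \<pi> q"
            unfolding x(1) using x(2) QY by (subst \<pi>_lcomb[symmetric]) (auto simp: \<pi>_simps)
          moreover have "\<pi> (f w) \<in> D (d - m)" if "w \<in> W" for w
            using IH(1) x(2) that by blast
          then have "(\<Sum>w\<in>W. r w * \<pi> (f w)) \<in> D d"
            using rD[of _ _ "d - m"] dm by (intro fa.subspace_sum[OF subD]) simp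
          moreover have "\<pi> q \<in> D d" using IH(2) x(3) D_mono[of "d - 1" d] by auto
          ultimately show "x \<in> D d" using fa.subspace_add[OF subD] by simp
        qed
        show "D d \<subseteq> \<pi> ` Q d"
        proof
          fix u assume "u \<in> D d"
          then obtain g where g: "\<forall>w\<in>W. g w \<in> D (d - m)" "u - (\<Sum>w\<in>W. r w * g w) \<in> D (d - 1)"
            using decomp[of d u] False unfolding lcomb_def by auto
          have "\<forall>w\<in>W. \<exists>q\<in>Q (d - m). \<pi> q = g w" using g(1) IH(1) by (metis imageE)
          then obtain f where f: "\<And>w. w \<in> W \<Longrightarrow> f w \<in> Q (d - m) \<and> \<pi> (f w) = g w" by metis
          have "u - (\<Sum>w\<in>W. r w * g w) \<in> \<pi> ` Q (d - 1)" using g(2) IH(2) by simp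
          then obtain q where q: "q \<in> Q (d - 1)" "\<pi> q = u - (\<Sum>w\<in>W. r w * g w)"
            by (elim imageE) simp
          have "\<pi> (\<Sum>w\<in>W. \<rho> w * f w) = (\<Sum>w\<in>W. r w * g w)"
            using f QY by (subst \<pi>_lcomb) (auto intro: sum.cong)
          then have "u = \<pi> ((\<Sum>w\<in>W. \<rho> w * f w) + q)" by (simp add: \<pi>_simps q)
          moreover have "(\<Sum>w\<in>W. \<rho> w * f w) + q \<in> Q d"
            using False f q by (auto simp: Q_high lcomb_def)
          ultimately show "u \<in> \<pi> ` Q d" by blast
        qed
      qed
    qed
  qed

  obtain Gi where Gi: "finite Gi" "fa.span Gi = {l \<in> L. \<pi> l = 0}"
  proof -
    have "fa.subspace (L \<inter> {l. \<pi> l = 0})"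
      using subL module_hom.subspace_kernel[OF hom] by (rule fa.subspace_inter)
    then show ?thesis
      using that fa.submodule_fg[OF noeth finV, of "{l \<in> L. \<pi> l = 0}"]
      by (auto simp: L_def Int_def)
  qed
  have QL: "Q (N - m) \<subseteq> L" using Q_N Q_mono[of "N - m" N] by auto
  obtain Ge where Ge: "finite Ge" "fa.span Ge = Q (N - m)"
    using fa.submodule_fg[OF noeth finV subQ, of "N - m"] QL by (auto simp: L_def)
  \<comment> \<open>The bound 2 N is the degree of a product of two generators, each of degree at
    most \<open>N\<close>.\<close>
  have "\<exists>q\<in>Q (2 * N). \<pi> q = x" if "x \<in> D (2 * N)" for x using \<pi>Q that by (metis imageE)
  then obtain \<sigma> where \<sigma>: "\<sigma> x \<in> Q (2 * N)" "\<pi> (\<sigma> x) = x" if "x \<in> D (2 * N)" for x by metis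
  \<comment> \<open>\<open>Gi\<close>: linear relations; \<open>He\<close>: products landing in degree at most \<open>N\<close> become linear, which is
    what the descent from \<open>N + 1\<close> to \<open>N\<close> needs; \<open>Hv\<close>: products of generators lie in the
    filtration, so that it exhausts the quotient.\<close>
  define He where "He = (\<lambda>(w, e). \<rho> w * e - \<nu> (\<pi> (\<rho> w * e))) ` (W \<times> Ge)"
  define Hv where "Hv = (\<lambda>(v, v'). v * v' - \<sigma> (\<pi> (v * v'))) ` (V \<times> V)"
  have \<rho>e: "\<pi> (\<rho> w * e) \<in> D N" if "w \<in> W" "e \<in> Ge" for w e
  proof -
    have e: "e \<in> Q (N - m)" using fa.span_base that(2) Ge(2) by blast
    then have "e \<in> fcar Y" using QY by blast
    then have "\<pi> (\<rho> w * e) = r w * \<pi> e" using \<rho>Y \<rho>(2) that(1) by (simp add: \<pi>_mult)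
    moreover have "\<pi> e \<in> D (N - m)" using e \<pi>Q by blast
    ultimately show ?thesis using rD[OF that(1), of "\<pi> e" "N - m"] by (simp add: N_def m_def mult_2)
  qed
  have VL: "V \<subseteq> L" unfolding L_def by (rule fa.span_superset)
  have vv: "\<pi> (v * v') \<in> D (2 * N)" if "v \<in> V" "v' \<in> V" for v v'
  proof -
    have "v \<in> L" "v' \<in> L" using that VL by auto
    then have "\<pi> (v * v') = \<pi> v * \<pi> v'" "\<pi> v \<in> D N" "\<pi> v' \<in> D N"
      using \<pi>_mult LY \<pi>L by auto
    then show ?thesis
      using fdeg_mult[of "\<pi> v" X N "\<pi> v'" N] fa.subalgD(2)[OF B(1)] by (auto simp: D_def mult_2)
  qed
  have "fa.presents Y b (Gi \<union> He \<union> Hv) B"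
  proof (rule fa.presentsI)
    show "finite Y" by (simp add: Y_def)
    show "fa.eval b ` fcar Y = B"
    proof
      show "fa.eval b ` fcar Y \<subseteq> B" using \<pi>B by (auto simp: \<pi>_def)
      show "B \<subseteq> fa.eval b ` fcar Y"
      proof
        fix x assume "x \<in> B"
        then obtain d where "x \<in> D d" using fcar_in_fdeg[of x X] B(2) by (auto simp: D_def)
        then show "x \<in> fa.eval b ` fcar Y" using \<pi>Q[of d] QY[of d] by (auto simp: \<pi>_def)
      qed
    qed
    show "finite (Gi \<union> He \<union> Hv)" by (simp add: Gi Ge He_def Hv_def finW finV)
    have "Gi \<subseteq> L" using fa.span_superset[of Gi] Gi by auto
    moreover have "He \<subseteq> fcar Y"
    proof -
      have "\<rho> w * e - \<nu> (\<pi> (\<rho> w * e)) \<in> fcar Y" if w: "w \<in> W" and e: "e \<in> Ge" for w e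
      proof (rule fa.subspace_diff[OF subspace_fcar])
        have "e \<in> fcar Y" using fa.span_base[OF e] Ge(2) QY by blast
        then show "\<rho> w * e \<in> fcar Y" using \<rho>Y[OF w] by (simp add: fcar_mult)
        show "\<nu> (\<pi> (\<rho> w * e)) \<in> fcar Y" using \<nu>(1)[OF \<rho>e[OF w e]] LY by blast
      qed
      then show ?thesis by (auto simp: He_def)
    qed
    moreover have "Hv \<subseteq> fcar Y"
    proof -
      have "v * v' - \<sigma> (\<pi> (v * v')) \<in> fcar Y" if v: "v \<in> V" "v' \<in> V" for v v'
      proof (rule fa.subspace_diff[OF subspace_fcar])
        have "v \<in> fcar Y" "v' \<in> fcar Y" using v VL LY by blast+
        then show "v * v' \<in> fcar Y" by (rule fcar_mult)
        show "\<sigma> (\<pi> (v * v')) \<in> fcar Y" using \<sigma>(1)[OF vv[OF v]] QY by blast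
      qed
      then show ?thesis by (auto simp: Hv_def)
    qed
    ultimately show "Gi \<union> He \<union> Hv \<subseteq> fcar Y" using LY by blast
    have "\<pi> g = 0" if "g \<in> Gi" for g using fa.span_base[OF that] Gi(2) by simp
    then show "fa.eval b g = 0" if "g \<in> Gi \<union> He \<union> Hv" for g
      using that \<nu>(2)[OF \<rho>e] \<sigma>(2)[OF vv]
      by (auto simp: He_def Hv_def module_hom.diff[OF hom] simp flip: \<pi>_def)
  next
    fix I p assume I: "fa.ideal_in (fcar Y) I" and HI: "Gi \<union> He \<union> Hv \<subseteq> I"
      and Iker: "\<And>q. q \<in> I \<Longrightarrow> fa.eval b q = 0"
      and p: "p \<in> fcar Y" "fa.eval b p = 0"
    note subI = fa.ideal_inD(1)[OF I]
    note Imult = fa.ideal_inD(3,4)[OF I]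
    have Iker: "\<pi> q = 0" if "q \<in> I" for q using Iker that by (simp add: \<pi>_def)
    define QI where "QI d = {q + i |q i. q \<in> Q d \<and> i \<in> I}" for d
    have subQI: "fa.subspace (QI d)" for d
      unfolding QI_def using subQ subI by (rule fa.subspace_plus)
    have Q_QI: "Q d \<subseteq> QI d" for d
      unfolding QI_def using fa.subspace_0[OF subI] by force
    have I_QI: "I \<subseteq> QI d" for d
      unfolding QI_def using fa.subspace_0[OF subQ] by force
    \<comment> \<open>Beyond \<open>N\<close> this is the recursion for \<open>Q\<close>. At
      \<open>d + m = N\<close> that recursion does not apply, and the relations \<open>He\<close>
      replace it.\<close>
    have \<rho>_step: "\<rho> w * q \<in> QI (d + m)" if "w \<in> W" "q \<in> Q d" "N \<le> d + m" for w q d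
    proof (cases "d + m = N")
      case True
      then have "d = N - m" by simp
      then have "q \<in> fa.span Ge" using that(2) Ge(2) by simp
      then show ?thesis
      proof (rule fa.span_induct)
        show "fa.subspace {q. \<rho> w * q \<in> QI (d + m)}"
          by (rule fa.subspace_mult_vimage[OF subQI])
        fix e assume e: "e \<in> Ge"
        have "\<nu> (\<pi> (\<rho> w * e)) \<in> Q N" "\<rho> w * e - \<nu> (\<pi> (\<rho> w * e)) \<in> I"
          using \<nu>(1)[OF \<rho>e[OF that(1) e]] Q_N HI that(1) e unfolding He_def by blast+
        then have "\<nu> (\<pi> (\<rho> w * e)) + (\<rho> w * e - \<nu> (\<pi> (\<rho> w * e))) \<in> QI N"
          unfolding QI_def by blast
        then show "\<rho> w * e \<in> QI (d + m)" using True by simp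
      qed
    next
      case False
      then have "\<rho> w * q \<in> lcomb \<rho> W (Q (d + m - m))"
        using that fa.subspace_0[OF subQ] by (intro mult_in_lcomb finW) simp_all
      moreover have "N < d + m" using False that(3) by simp
      ultimately have "\<rho> w * q + 0 \<in> Q (d + m)"
        using fa.subspace_0[OF subQ] unfolding Q_high[OF \<open>N < d + m\<close>] by blast
      then show ?thesis using Q_QI by (simp add: subset_iff)
    qed
    \<comment> \<open>The induction is strong because the descent consumes relations in
      \<open>Q (d - m)\<close> as well as in \<open>Q (d - 1)\<close>.\<close>
    have inj: "q \<in> I" if "q \<in> Q d" "\<pi> q = 0" for q d
      using that
    proof (induction d arbitrary: q rule: less_induct)
      case (less d)
      show ?case
      proof (cases "d \<le> N")
        case True
        then have "q \<in> fa.span Gi" using less.prems Gi by (simp add: Q_low)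
        then show ?thesis using fa.span_minimal[of Gi I] HI subI by blast
      next
        case False
        obtain f q' where q: "q = (\<Sum>w\<in>W. \<rho> w * f w) + q'" "q' \<in> Q (d - 1)"
          and f: "\<And>w. w \<in> W \<Longrightarrow> f w \<in> Q (d - m)"
          using less.prems(1) False by (auto simp: Q_high lcomb_def)
        have fd: "\<pi> (f w) \<in> fdeg X (d - m)" if "w \<in> W" for w
          using f[OF that] \<pi>Q[of "d - m"] by (auto simp: D_def)
        have dm: "d - 1 = n + (d - m)" using False by (simp add: m_def N_def)
        \<comment> \<open>Replacing \<open>r w\<close> by its leading word only changes terms of degree below \<open>d\<close>.\<close>
        define s where "s = (\<Sum>w\<in>W. word w * \<pi> (f w))"
        have "s \<in> fdeg X (d - 1)"
        proof -
          have "(\<Sum>w\<in>W. r w * \<pi> (f w)) + \<pi> q' = 0"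
          proof -
            have "\<pi> (\<Sum>w\<in>W. \<rho> w * f w) = (\<Sum>w\<in>W. r w * \<pi> (f w))"
              by (rule \<pi>_lcomb) (use f QY in blast)
            then show ?thesis
              using less.prems(2) unfolding q(1) module_hom.add[OF hom] by simp
          qed
          then have "s = (\<Sum>w\<in>W. (word w - r w) * \<pi> (f w)) - \<pi> q'"
            by (simp add: s_def left_diff_distrib sum_subtractf add_eq_0_iff)
          moreover have "(word w - r w) * \<pi> (f w) \<in> fdeg X (d - 1)" if "w \<in> W" for w
            unfolding dm using r(2)[OF that] fd[OF that] by (rule fdeg_mult)
          then have "(\<Sum>w\<in>W. (word w - r w) * \<pi> (f w)) \<in> fdeg X (d - 1)"
            by (rule fa.subspace_sum[OF subspace_fdeg])
          moreover have "\<pi> q' \<in> fdeg X (d - 1)" using q(2) \<pi>Q[of "d - 1"] by (auto simp: D_def)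
          ultimately show ?thesis using fa.subspace_diff[OF subspace_fdeg] by simp
        qed
        \<comment> \<open>By equal length of the words in \<open>W\<close>, the coefficient of
          \<open>s\<close> at \<open>w @ v\<close> comes from the summand of \<open>w\<close> alone.
          A term of full degree d - m in \<open>\<pi> (f w)\<close> would therefore survive in
          \<open>s\<close>, whose degree is below d.\<close>
        have "\<pi> (f w) \<in> D (d - 1 - m)" if w: "w \<in> W" for w
        proof -
          have "length v \<le> d - 1 - m" if v: "v \<in> supp (\<pi> (f w))" for v
          proof (rule ccontr)
            assume "\<not> length v \<le> d - 1 - m"
            moreover have "length v \<le> d - m" using fd[OF w] v by (simp add: fdeg_def)
            ultimately have "length (w @ v) = d" using w False by (simp add: W_def m_def N_def)
            moreover have "coeff s (w @ v) = (\<Sum>u\<in>W. if u = w then coeff (\<pi> (f w)) v else 0)"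
              unfolding s_def lookup_sum
              by (rule sum.cong) (use w in \<open>auto simp: lookup_word_mult W_def\<close>)
            then have "coeff s (w @ v) = coeff (\<pi> (f w)) v" using w finW by simp
            then have "w @ v \<in> supp s" using v by (metis in_keys_iff)
            then have "length (w @ v) \<le> d - 1"
              using \<open>s \<in> fdeg X (d - 1)\<close> by (simp add: fdeg_def del: length_append)
            ultimately show False using False by simp
          qed
          then show ?thesis
            using fd[OF w] f[OF w] \<pi>Q[of "d - m"] by (auto simp: fdeg_def D_def)
        qed
        \<comment> \<open>The value of \<open>f w\<close> is thus attained one step lower in the
          filtration. Replacing \<open>f w\<close> by such an \<open>f' w\<close> costs a relation
          in \<open>Q (d - m)\<close>, which the induction hypothesis puts into
          \<open>I\<close>.\<close>
        then have "\<forall>w\<in>W. \<exists>q\<in>Q (d - 1 - m). \<pi> q = \<pi> (f w)" using \<pi>Q by (metis imageE)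
        then obtain f' where f': "\<And>w. w \<in> W \<Longrightarrow> f' w \<in> Q (d - 1 - m) \<and> \<pi> (f' w) = \<pi> (f w)"
          by metis
        have diffI: "\<rho> w * (f w - f' w) \<in> I" if w: "w \<in> W" for w
        proof -
          have "d - 1 - m \<le> d - m" by simp
          then have "f' w \<in> Q (d - m)" using f'[OF w] Q_mono by blast
          then have "f w - f' w \<in> Q (d - m)" using f[OF w] by (intro fa.subspace_diff[OF subQ])
          then have "f w - f' w \<in> I"
            using less.IH[of "d - m"] False f'[OF w] by (auto simp: m_def \<pi>_simps)
          then show ?thesis using Imult(1) \<rho>Y[OF w] by blast
        qed
        \<comment> \<open>As \<open>d - 1 \<ge> N \<ge> m\<close>, the truncated subtraction is
          exact.\<close>
        have "d - 1 - m + m = d - 1" "N \<le> d - 1" using False by (auto simp: m_def N_def)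
        then have step: "\<rho> w * f' w \<in> QI (d - 1)" if "w \<in> W" for w
          using \<rho>_step[OF that, of "f' w" "d - 1 - m"] f'[OF that] by simp
        have "\<rho> w * f w \<in> QI (d - 1)" if w: "w \<in> W" for w
        proof -
          have "\<rho> w * f' w + \<rho> w * (f w - f' w) \<in> QI (d - 1)"
            using step[OF w] diffI[OF w] I_QI by (intro fa.subspace_add[OF subQI]) auto
          then show ?thesis by (simp add: right_diff_distrib)
        qed
        then have "q \<in> QI (d - 1)"
          unfolding q(1) using q(2) Q_QI
          by (intro fa.subspace_add[OF subQI] fa.subspace_sum[OF subQI]) auto
        then obtain x i where x: "q = x + i" "x \<in> Q (d - 1)" "i \<in> I" unfolding QI_def by blast
        then have "\<pi> x = 0" using less.prems(2) Iker by (simp add: \<pi>_simps)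
        then have "x \<in> I" using less.IH[of "d - 1"] x(2) False by simp
        then show ?thesis unfolding x(1) using x(3) fa.subspace_add[OF subI] by blast
      qed
    qed
    \<comment> \<open>It remains to see that \<open>M\<close> contains all of \<open>fcar Y\<close>.
      The recursion for \<open>Q\<close> only provides left multiplication by the
      \<open>\<rho> w\<close>; left multiplication by arbitrary letters has to be derived.\<close>
    define M where "M = (\<Union>d. QI d)"
    have QI_mono: "QI d \<subseteq> QI e" if "d \<le> e" for d e
      using Q_mono[OF that] unfolding QI_def by blast
    have QIM: "QI d \<subseteq> M" for d unfolding M_def by blast
    have M_add: "x + y \<in> M" if "x \<in> M" "y \<in> M" for x y
    proof -
      obtain d e where "x \<in> QI d" "y \<in> QI e" using \<open>x \<in> M\<close> \<open>y \<in> M\<close> unfolding M_def by blast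
      then have "x \<in> QI (max d e)" "y \<in> QI (max d e)"
        using QI_mono[of d "max d e"] QI_mono[of e "max d e"] by (simp_all add: subset_iff)
      then show ?thesis using fa.subspace_add[OF subQI] QIM by blast
    qed
    have subM: "fa.subspace M"
      unfolding fa.subspace_def
    proof (intro conjI ballI allI M_add)
      show "0 \<in> M" using fa.subspace_0[OF subQI] QIM by blast
      show "fscale c x \<in> M" if "x \<in> M" for c x
        using that fa.subspace_scale[OF subQI] unfolding M_def by blast
    qed
    have QM: "Q d \<subseteq> M" for d using Q_QI QIM by blast
    have IM: "I \<subseteq> M" using I_QI QIM by blast
    have LM: "L \<subseteq> M" using QM[of N] Q_N by simp
    have M_split: "\<exists>d q i. x = q + i \<and> q \<in> Q d \<and> i \<in> I" if "x \<in> M" for x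
      using that unfolding M_def QI_def by blast
    have \<rho>M: "\<rho> w * x \<in> M" if w: "w \<in> W" and "x \<in> M" for w x
    proof -
      obtain d q i where x: "x = q + i" "q \<in> Q d" "i \<in> I" using M_split[OF \<open>x \<in> M\<close>] by blast
      have "q \<in> Q (max d N)" using x(2) Q_mono[of d "max d N"] by (simp add: subset_iff)
      then have "\<rho> w * q \<in> QI (max d N + m)" using w by (intro \<rho>_step) simp_all
      moreover have "\<rho> w * i \<in> I" using Imult(1) \<rho>Y[OF w] x(3) by blast
      ultimately show ?thesis
        unfolding x(1) distrib_left using IM QIM by (intro M_add) blast+
    qed
    \<comment> \<open>Unfolding \<open>q\<close> brings factors \<open>\<rho> w\<close> to the
      front, where \<open>\<rho>M\<close> absorbs them; what finally meets \<open>f\<close> is a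
      linear form.\<close>
    have right: "q * f \<in> M" if "q \<in> Q d" and f: "\<And>l. l \<in> L \<Longrightarrow> l * f \<in> M" for q f d
      using that(1)
    proof (induction d arbitrary: q rule: less_induct)
      case (less d)
      show ?case
      proof (cases "d \<le> N")
        case True
        then show ?thesis using less.prems f by (simp add: Q_low)
      next
        case False
        then obtain g q' where q: "q = (\<Sum>w\<in>W. \<rho> w * g w) + q'" "q' \<in> Q (d - 1)"
          and g: "\<And>w. w \<in> W \<Longrightarrow> g w \<in> Q (d - m)"
          using less.prems by (auto simp: Q_high lcomb_def)
        have "q' * f \<in> M" using less.IH[of "d - 1"] q(2) False by simp
        moreover have "g w * f \<in> M" if "w \<in> W" for w
          using less.IH[of "d - m"] g[OF that] False by (simp add: m_def)
        then have "(\<Sum>w\<in>W. \<rho> w * (g w * f)) \<in> M"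
          using \<rho>M by (intro fa.subspace_sum[OF subM]) simp
        ultimately show ?thesis
          using M_add by (simp add: q(1) distrib_right sum_distrib_right mult.assoc)
      qed
    qed
    have LL: "l * l' \<in> M" if "l \<in> L" "l' \<in> L" for l l'
      using that(1) unfolding L_def
    proof (rule fa.span_induct)
      show "fa.subspace {l. l * l' \<in> M}" by (rule fa.subspace_mult_vimage[OF subM])
      fix v assume v: "v \<in> V"
      show "v * l' \<in> M"
        using that(2) unfolding L_def
      proof (rule fa.span_induct)
        show "fa.subspace {l'. v * l' \<in> M}" by (rule fa.subspace_mult_vimage[OF subM])
        fix v' assume v': "v' \<in> V"
        have "\<sigma> (\<pi> (v * v')) \<in> M" "v * v' - \<sigma> (\<pi> (v * v')) \<in> M"
          using \<sigma>(1)[OF vv[OF v v']] QM IM HI v v' by (auto simp: Hv_def)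
        from M_add[OF this] show "v * v' \<in> M" by simp
      qed
    qed
    \<comment> \<open>Regrouped as (l \<open>\<rho> w\<close>) (\<open>g w\<close>): by
      \<open>LL\<close> the first factor lies in some \<open>Q e + I\<close>, with no control over
      e. None is needed, since \<open>right\<close> asks only that linear forms take
      \<open>g w\<close> into \<open>M\<close>, which is the induction hypothesis at
      \<open>d - m\<close>.\<close>
    have LQ: "l * q \<in> M" if "q \<in> Q d" "l \<in> L" for q l d
      using that
    proof (induction d arbitrary: q l rule: less_induct)
      case (less d)
      show ?case
      proof (cases "d \<le> N")
        case True
        then show ?thesis using less.prems LL by (simp add: Q_low)
      next
        case False
        then obtain g q' where q: "q = (\<Sum>w\<in>W. \<rho> w * g w) + q'" "q' \<in> Q (d - 1)"
          and g: "\<And>w. w \<in> W \<Longrightarrow> g w \<in> Q (d - m)"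
          using less.prems(1) by (auto simp: Q_high lcomb_def)
        have "l * q' \<in> M" using less.IH[of "d - 1"] less.prems(2) q(2) False by simp
        moreover have "l * \<rho> w * g w \<in> M" if w: "w \<in> W" for w
        proof -
          obtain e x i where x: "l * \<rho> w = x + i" "x \<in> Q e" "i \<in> I"
            using M_split LL[OF less.prems(2) \<rho>(1)[OF w]] by blast
          have "x * g w \<in> M"
            using x(2) by (rule right) (use less.IH[of "d - m"] g[OF w] False in \<open>simp add: m_def\<close>)
          moreover have "i * g w \<in> M" using Imult(2) x(3) g[OF w] QY IM by blast
          ultimately show ?thesis unfolding x(1) distrib_right by (rule M_add)
        qed
        then have "(\<Sum>w\<in>W. l * (\<rho> w * g w)) \<in> M"
          by (intro fa.subspace_sum[OF subM]) (simp add: mult.assoc)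
        ultimately show ?thesis
          using M_add by (simp add: q(1) distrib_left sum_distrib_left)
      qed
    qed
    have VM: "v * x \<in> M" if v: "v \<in> V" and "x \<in> M" for v x
    proof -
      obtain d q i where x: "x = q + i" "q \<in> Q d" "i \<in> I" using M_split[OF \<open>x \<in> M\<close>] by blast
      have "v \<in> L" using v VL by blast
      then have "v * q \<in> M" "v * i \<in> M" using LQ[OF x(2)] Imult(1)[OF x(3)] LY IM by auto
      then show ?thesis unfolding x(1) distrib_left by (rule M_add)
    qed
    from p(1) have "p \<in> M"
    proof (induction p rule: fcar_induct)
      case subspace
      then show ?case using subM by simp
    next
      case (word w)
      then show ?case
      proof (induction w rule: list_nonempty_induct)
        case (single i)
        then have "word [i] \<in> V" by (simp add: V_def)
        then show ?case using VL LM by blast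
      next
        case (cons i w)
        then have "word [i] * word w \<in> M" by (intro VM) (auto simp: V_def)
        then show ?case by (simp add: word_mult)
      qed
    qed
    then obtain d q i where x: "p = q + i" "q \<in> Q d" "i \<in> I" using M_split by blast
    then have "\<pi> q = 0" using p(2) Iker by (simp add: \<pi>_simps flip: \<pi>_def)
    then have "q \<in> I" using inj x(2) by blast
    then show "p \<in> I" unfolding x(1) using x(3) fa.subspace_add[OF subI] by blast
  qed
  then show ?thesis by blast
qed

lemma (in k_algebra) presents_subalg:
  assumes noeth: "noetherian_cring TYPE('k)"
    and pres: "presents X a G UNIV" and B: "subalg smul B"
    and T: "finite T" and cof: "\<And>x. \<exists>b\<in>B. x - b \<in> span T"
  shows "\<exists>Y b H. presents Y b H B"
proof -
  have finX: "finite X" and onto: "eval a ` fcar X = UNIV" and G: "finite G" "G \<subseteq> fcar X"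
    "\<And>g. g \<in> G \<Longrightarrow> eval a g = 0"
    and ker: "\<And>I p. fa.ideal_in (fcar X) I \<Longrightarrow> G \<subseteq> I \<Longrightarrow> p \<in> fcar X \<Longrightarrow> eval a p = 0 \<Longrightarrow> p \<in> I"
    using pres unfolding presents_def by blast+
  define S where "S = {p \<in> fcar X. eval a p \<in> B}"
  have SX: "S \<subseteq> fcar X" by (auto simp: S_def)
  have S: "subalg fscale S"
    using subalgD[OF B] subspace_fcar[of X]
    by (auto simp: subalg_def S_def fa.subspace_def subspace_def eval_zero eval_add eval_scale
        eval_mult fcar_mult)
  obtain F where F: "finite F" "F \<subseteq> fcar X" "T = eval a ` F"
    using T onto finite_subset_image[of T "eval a" "fcar X"] by auto
  have cofF: "\<exists>s\<in>S. p - s \<in> fa.span F" if p: "p \<in> fcar X" for p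
  proof -
    obtain b where b: "b \<in> B" "eval a p - b \<in> span T" using cof by blast
    then obtain u where u: "u \<in> fa.span F" "eval a u = eval a p - b"
      unfolding F(3) module_hom.span_image[OF module_hom_eval] by (metis imageE)
    have "u \<in> fcar X" using u(1) fa.span_minimal[OF F(2) subspace_fcar] by blast
    then have "p - u \<in> S"
      using p b u(2) fa.subspace_diff[OF subspace_fcar] by (simp add: S_def eval_diff)
    then show ?thesis using u(1) by (intro bexI[of _ "p - u"]) simp_all
  qed
  have "\<exists>d. \<forall>t\<in>F. t \<in> fdeg X (d t)" using F(2) fcar_in_fdeg by (intro bchoice) blast
  then obtain d where d: "\<And>t. t \<in> F \<Longrightarrow> t \<in> fdeg X (d t)" by blast
  \<comment> \<open>This maximum plays the part of n. For empty \<open>F\<close> it is an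
    unspecified number, and the inclusion is trivial.\<close>
  have "F \<subseteq> fdeg X (Max (d ` F))"
  proof
    fix t assume t: "t \<in> F"
    then have "d t \<le> Max (d ` F)" using F(1) by simp
    then show "t \<in> fdeg X (Max (d ` F))" using d[OF t] fdeg_mono by blast
  qed
  then have "fa.span F \<subseteq> fdeg X (Max (d ` F))"
    by (rule fa.span_minimal[OF _ subspace_fdeg])
  then obtain Y b H where presS: "fa.presents Y b H S"
    using cofinite_subalg_presented[OF noeth finX S SX, of "Max (d ` F)"] cofF by blast
  \<comment> \<open>Generators of the kernel as an ideal of \<open>S\<close>, in the shape required
    by \<open>ideal_in_cofinite\<close>. They have value 0, hence lie in \<open>S\<close> because 0
    belongs to \<open>B\<close>.\<close>
  define E where
    "E = G \<union> (\<Union>t\<in>F. \<Union>g\<in>G. {t * g, g * t} \<union> (\<lambda>t'. t * g * t') ` F)"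
  have in_E: "g \<in> E" "t * g \<in> E" "g * t \<in> E" "t * g * t' \<in> E"
    if "t \<in> F" "g \<in> G" "t' \<in> F" for t g t'
    using that unfolding E_def by blast+
  have EX: "E \<subseteq> fcar X" using G(2) F(2) by (auto simp: E_def intro!: fcar_mult)
  have E0: "eval a e = 0" if "e \<in> E" for e
  proof -
    have "fa.ideal_in (fcar X) {p \<in> fcar X. eval a p = 0}" by (rule ideal_in_kernel)
    note K = fa.ideal_inD(3,4)[OF this]
    have "G \<subseteq> {p \<in> fcar X. eval a p = 0}" using G by blast
    then have "E \<subseteq> {p \<in> fcar X. eval a p = 0}"
      unfolding E_def using K F(2) by (auto simp: subset_iff)
    then show ?thesis using that by blast
  qed
  have "\<exists>G'. presents Y (\<lambda>i. eval a (b i)) G' (eval a ` S)"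
  proof (rule presents_eval_image[OF presS SX])
    show "finite E" by (simp add: E_def G F)
    show "E \<subseteq> S" using EX E0 subspace_0[OF subalgD(1)[OF B]] by (auto simp: S_def)
    show "eval a e = 0" if "e \<in> E" for e using E0 that .
    fix I p assume I: "fa.ideal_in S I" and EI: "E \<subseteq> I" and p: "p \<in> S" "eval a p = 0"
    have "\<exists>J. fa.ideal_in (fcar X) J \<and> G \<subseteq> J \<and> J \<subseteq> I"
    proof (rule fa.ideal_in_cofinite[OF subalg_fcar S SX F(2) cofF I])
      show "G \<subseteq> I" using EI unfolding E_def by blast
    qed (use in_E EI in \<open>blast\<close>)+
    then show "p \<in> I" using ker p SX by blast
  qed
  moreover have "eval a ` S = B"
  proof
    show "B \<subseteq> eval a ` S"
    proof
      fix x assume "x \<in> B"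
      moreover obtain p where "p \<in> fcar X" "x = eval a p" using onto by blast
      ultimately show "x \<in> eval a ` S" by (simp add: S_def)
    qed
  qed (auto simp: S_def)
  ultimately show ?thesis by auto
qed

theorem theorem1p1:
  fixes smul :: "'k::comm_ring_1 \<Rightarrow> 'a::ring \<Rightarrow> 'a"
    and B :: "'a set"
  assumes "noetherian_cring TYPE('k)"
    and "kalg smul"
    and "subalg smul B"
    and "fg_quotient_module smul B"
  shows "fin_pres smul (UNIV :: 'a set) \<longleftrightarrow> fin_pres smul B"
proof -
  interpret k_algebra smul using assms(2) by (simp add: kalg_iff_k_algebra)
  obtain T where T: "finite T" "\<And>x. \<exists>b\<in>B. \<exists>c. x = b + (\<Sum>t\<in>T. smul (c t) t)"
    using assms(4) unfolding fg_quotient_module_def by blast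
  have cof: "\<exists>b\<in>B. x - b \<in> span T" for x
  proof -
    obtain b c where "b \<in> B" "x = b + (\<Sum>t\<in>T. smul (c t) t)" using T(2) by blast
    then show ?thesis by (intro bexI[of _ b]) (auto intro!: span_sum span_scale intro: span_base)
  qed
  show ?thesis
    using presents_extend[OF assms(1) _ assms(3) T(1) cof]
      presents_subalg[OF assms(1) _ assms(3) T(1) cof]
      presents_imp_fin_pres fin_pres_imp_presents by metis
qed

end
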